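(* Let $Q(a,z)=\Gamma(a,z)/\Gamma(a)$ be the normalised upper incomplete gamma function. For every $m=0,1,2,\ldots$, $$Q(a,a)=\frac{1}{2}-\frac{1}{\sqrt{2\pi a}}\sum_{k=0}^{m}E_k\,a^{-k}+O(a^{-m-1})$$ as $a\to\infty$ in the sector $|\arg a|<\tfrac12\pi$, where the coefficients $E_k$ are those determined by $$\frac{\sum_{k=0}^{m}B_{2k+1}(0)\,a^{-k}}{\sum_{k=0}^{m}A_{2k}(0)\,a^{-k}}=\sum_{k=0}^{m}E_k\,a^{-k}+O(a^{-m-1})\qquad (a\to\infty)$$ (equivalently, $\sum_{k\ge0}E_k x^k$ is the quotient of the formal power series $\sum_{k\ge0}B_{2k+1}(0)x^k$ and $\sum_{k\ge0}A_{2k}(0)x^k$), with $A_k(\chi)$, $B_k(\chi)$ the polynomials defined in the context. The first coefficients are $$E_0=\tfrac13,\quad E_1=\tfrac{1}{540},\quad E_2=-\tfrac{25}{6048},\quad E_3=-\tfrac{101}{155520},\quad E_4=\tfrac{3184811}{3695155200},$$ $$E_5=\tfrac{2745493}{8151736320},\quad E_6=-\tfrac{119937661}{225740390400},\quad E_7=-\tfrac{8325705316049}{24176795811840000}.$$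
   Context: The upper incomplete gamma function is $\Gamma(a,z)=\int_z^\infty t^{a-1}e^{-t}\,dt$ for $|\arg z|<\pi$, where the integration path does not cross the negative real axis, and $Q(a,z)=\Gamma(a,z)/\Gamma(a)$. Powers and square roots take their principal values. The 3-associated Stirling numbers of the second kind $S_3(k,j)$ ($0\le j\le\lfloor k/3\rfloor$) are defined by $$\exp\left[u\left(\frac{t^3}{3!}+\frac{t^4}{4!}+\cdots\right)\right]=\sum_{k=0}^\infty\sum_{j=0}^{\lfloor k/3\rfloor}S_3(k,j)\,\frac{u^jt^k}{k!},$$ with $S_3(k,j)=0$ for $j>\lfloor k/3\rfloor$; in particular $S_3(k,0)=\delta_{0k}$. The polynomials $p_k(\chi)$ and $q_k(\chi)$ are defined by the recurrence $$y_{k+1}(\chi)=\frac{1}{k+1}\{y_{k-1}(\chi)-\chi\,y_k(\chi)\}\qquad(k=0,1,2,\ldots),$$ which both $y_k=p_k$ and $y_k=q_k$ satisfy, with starting values $(p_{-1},p_0)=(0,1)$ and $(q_{-1},q_0)=(-1,0)$. The polynomials $A_k(\chi)$ and $B_k(\chi)$ ($k=0,1,2,\ldots$) are $$A_k(\chi)=\sum_{j=0}^k(-1)^jS_3(k+2j,j)\,p_{k+2j}(\chi),\qquad B_k(\chi)=\sum_{j=0}^k(-1)^jS_3(k+2j,j)\,q_{k+2j}(\chi).$$ For example, $A_0(\chi)=1$, $B_0(\chi)=0$, $A_1(\chi)=\tfrac12\chi+\tfrac16\chi^3$, $B_1(\chi)=\tfrac13+\tfrac16\chi^2$. *)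

theory Defs
  imports
    "HOL-Analysis.Analysis"
    "HOL-Library.Landau_Symbols"
    "HOL-Computational_Algebra.Computational_Algebra"
begin

unbundle no vec_syntax
unbundle fps_syntax

(* The path of integration is the horizontal ray from z to z + infinity. For z off the closed
   negative real axis it does not meet that axis, and the integral converges absolutely for
   every a. *)
definition upper_Gamma :: "complex \<Rightarrow> complex \<Rightarrow> complex" where
  "upper_Gamma a z =
     (LBINT s:{0..}. (z + of_real s) powr (a - 1) * exp (- (z + of_real s)))"

definition Gamma_Q :: "complex \<Rightarrow> complex \<Rightarrow> complex" where
  "Gamma_Q a z = upper_Gamma a z / Gamma a"

(* The limit a \<longlongrightarrow> \<infinity> is uniform in arg a over the whole open sector. *)
definition at_infinity_sector :: "real \<Rightarrow> complex filter" where
  "at_infinity_sector \<theta> = inf at_infinity (principal {a. a \<noteq> 0 \<and> \<bar>Arg a\<bar> < \<theta>})"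

lemma eventually_at_infinity_sector:
  "eventually P (at_infinity_sector \<theta>) \<longleftrightarrow>
     (\<exists>R. \<forall>a. R \<le> norm a \<and> a \<noteq> 0 \<and> \<bar>Arg a\<bar> < \<theta> \<longrightarrow> P a)"
  by (auto simp: at_infinity_sector_def eventually_inf_principal eventually_at_infinity)

definition exp_tail3 :: "'a::field_char_0 fps" where
  "exp_tail3 = Abs_fps (\<lambda>n. if n < 3 then 0 else 1 / fact n)"

(* fps_exp u oo f is exp (u * f). To treat u as an indeterminate over a field, as fps_exp
   requires, it is taken to be the generator fls_X of the field of formal Laurent series. *)
definition stirling3 :: "nat \<Rightarrow> nat \<Rightarrow> complex" where
  "stirling3 k j = fact k * fls_nth ((fps_exp (fls_X :: complex fls) oo exp_tail3) $ k) (int j)"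

(* Indices are shifted by one: chi_rec u v n is y_(n-1) for the solution of the recurrence
   with y_(-1) = u and y_0 = v. *)
fun chi_rec :: "complex poly \<Rightarrow> complex poly \<Rightarrow> nat \<Rightarrow> complex poly" where
  "chi_rec u v 0 = u"
| "chi_rec u v (Suc 0) = v"
| "chi_rec u v (Suc (Suc k)) =
     smult (1 / of_nat (k + 1)) (chi_rec u v k - [:0, 1:] * chi_rec u v (Suc k))"

definition p_poly :: "nat \<Rightarrow> complex poly" where
  "p_poly k = chi_rec 0 1 (Suc k)"

definition q_poly :: "nat \<Rightarrow> complex poly" where
  "q_poly k = chi_rec (-1) 0 (Suc k)"

definition A_poly :: "nat \<Rightarrow> complex poly" where
  "A_poly k = (\<Sum>j\<le>k. smult ((-1) ^ j * stirling3 (k + 2 * j) j) (p_poly (k + 2 * j)))"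

definition B_poly :: "nat \<Rightarrow> complex poly" where
  "B_poly k = (\<Sum>j\<le>k. smult ((-1) ^ j * stirling3 (k + 2 * j) j) (q_poly (k + 2 * j)))"

definition E_coeff :: "nat \<Rightarrow> complex" where
  "E_coeff k = fps_nth (Abs_fps (\<lambda>i. poly (B_poly (2 * i + 1)) 0) /
                        Abs_fps (\<lambda>i. poly (A_poly (2 * i)) 0)) k"

lemma exp_tail3_power_nth_eq_0:
  assumes "k < 3 * j"
  shows "(exp_tail3 ^ j :: 'a::field_char_0 fps) $ k = 0"
proof -
  define g :: "'a fps" where "g = Abs_fps (\<lambda>n. 1 / fact (n + 3))"
  have e: "exp_tail3 = fps_X ^ 3 * g"
    by (intro fps_ext) (auto simp: exp_tail3_def g_def fps_X_power_mult_nth)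
  have "exp_tail3 ^ j = fps_X ^ (3 * j) * g ^ j"
    unfolding e power_mult_distrib power_mult ..
  thus ?thesis
    using assms by (simp add: fps_X_power_mult_nth)
qed

lemma exp_tail3_power_fls:
  "(exp_tail3 ^ j :: complex fls fps) $ k = fls_const ((exp_tail3 ^ j) $ k)"
proof (induction j arbitrary: k)
  case 0
  then show ?case by simp
next
  case (Suc j)
  have fact_const: "fact n = fls_const (fact n :: complex)" for n
    by (metis fls_of_nat of_nat_fact)
  have e: "(exp_tail3 :: complex fls fps) $ i = fls_const (exp_tail3 $ i)" for i
    by (simp add: exp_tail3_def fact_const fls_const_divide_const flip: fls_const_1)
  have "(exp_tail3 ^ Suc j :: complex fls fps) $ k =
          (\<Sum>i=0..k. fls_const (exp_tail3 $ i) * fls_const ((exp_tail3 ^ j) $ (k - i)))"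
    by (simp add: fps_mult_nth Suc.IH e)
  also have "\<dots> = (\<Sum>i=0..k. fls_const (exp_tail3 $ i * (exp_tail3 ^ j) $ (k - i)))"
    by simp
  also have "\<dots> = fls_const (\<Sum>i=0..k. exp_tail3 $ i * (exp_tail3 ^ j) $ (k - i))"
    by (rule fls_eqI) (simp add: fls_nth_sum)
  finally show ?case by (simp add: fps_mult_nth)
qed

lemma stirling3_altdef: "stirling3 k j = fact k / fact j * (exp_tail3 ^ j) $ k"
proof -
  have fact_const: "fact n = fls_const (fact n :: complex)" for n
    by (metis fls_of_nat of_nat_fact)
  have "fls_nth ((fps_exp (fls_X :: complex fls) oo exp_tail3) $ k) (int j) =
        (\<Sum>i=0..k. if i = j then (exp_tail3 ^ j) $ k / fact j else 0)"
    unfolding fps_compose_nth fls_nth_sum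
  proof (intro sum.cong refl)
    fix i
    have "fps_exp (fls_X :: complex fls) $ i * exp_tail3 ^ i $ k =
            fls_const ((exp_tail3 ^ i) $ k / fact i) * fls_X ^ i"
      by (simp add: exp_tail3_power_fls fact_const divide_inverse fls_inverse_const
            flip: fls_const_mult_const)
    thus "fls_nth (fps_exp (fls_X :: complex fls) $ i * exp_tail3 ^ i $ k) (int j) =
            (if i = j then (exp_tail3 ^ j) $ k / fact j else 0)"
      by simp
  qed
  also have "\<dots> = (exp_tail3 ^ j) $ k / fact j"
    using exp_tail3_power_nth_eq_0[of k j, where 'a = complex] by (cases "j \<le> k") auto
  finally show ?thesis
    by (simp add: stirling3_def)
qed

lemma stirling3_eq_0: "j > k div 3 \<Longrightarrow> stirling3 k j = 0"
  by (simp add: stirling3_altdef exp_tail3_power_nth_eq_0)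

lemma stirling3_0_right: "stirling3 k 0 = (if k = 0 then 1 else 0)"
  by (simp add: stirling3_altdef)

lemma stirling3_generating_function:
  fixes u :: complex
  shows "fps_exp u oo exp_tail3 =
           Abs_fps (\<lambda>k. \<Sum>j\<le>k div 3. stirling3 k j * u ^ j / fact k)"
proof (rule fps_ext)
  fix k
  have "(fps_exp u oo exp_tail3) $ k = (\<Sum>j=0..k. stirling3 k j * u ^ j / fact k)"
    unfolding fps_compose_nth by (simp add: stirling3_altdef field_simps)
  also have "\<dots> = (\<Sum>j\<le>k div 3. stirling3 k j * u ^ j / fact k)"
    by (intro sum.mono_neutral_right) (auto simp: stirling3_eq_0)
  finally show "(fps_exp u oo exp_tail3) $ k =
      Abs_fps (\<lambda>k. \<Sum>j\<le>k div 3. stirling3 k j * u ^ j / fact k) $ k"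
    by simp
qed

lemma A_B_poly_examples:
  "A_poly 0 = 1" "B_poly 0 = 0"
  "A_poly 1 = [:0, 1/2, 0, 1/6:]" "B_poly 1 = [:1/3, 0, 1/6:]"
proof -
  have s: "stirling3 3 1 = 1" "stirling3 (Suc (Suc (Suc 0))) (Suc 0) = 1"
    by (simp_all add: stirling3_altdef exp_tail3_def numeral_3_eq_3)
  show "A_poly 0 = 1" "B_poly 0 = 0"
    by (simp_all add: A_poly_def B_poly_def p_poly_def q_poly_def stirling3_0_right)
  show "A_poly 1 = [:0, 1/2, 0, 1/6:]" "B_poly 1 = [:1/3, 0, 1/6:]"
    by (simp_all add: A_poly_def B_poly_def p_poly_def q_poly_def stirling3_0_right s
          numeral_eq_Suc one_pCons)
qed

end

theory Submission
  imports
    Defs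
    "HOL-Complex_Analysis.Complex_Analysis"
    "HOL-Probability.Distributions"
    "HOL-Real_Asymp.Real_Asymp"
begin

text \<open>
  Put \<open>\<psi>(s) = exp s - 1 - s\<close> and \<open>K = a\<^sup>a exp(-a)\<close>, and let \<open>F\<close> be an entire primitive of
  \<open>exp(-a \<psi>(s))\<close>. Substituting \<open>t = a exp s\<close> shows \<open>\<Gamma>(a,a) = K (L - F(0))\<close> and \<open>\<Gamma>(a) = K (L - L')\<close>,
  where \<open>L\<close> and \<open>L'\<close> are the limits of \<open>F\<close> at the right and left end of the line \<open>Im s = - arg a\<close>.
  With \<open>\<epsilon> = a\<^bsup>-1/2\<^esup>\<close> the segments from \<open>0\<close> to \<open>\<plusminus>\<epsilon>/|\<epsilon>|\<close> are directions of steepest descent, on which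
  \<open>a s\<^sup>2\<close> is real, and the remaining pieces of the path are exponentially small, uniformly for
  \<open>Re a > 0\<close>. On the segments \<open>exp(-a(\<psi>(s) - s\<^sup>2/2))\<close> is expanded in powers of \<open>s\<close> for fixed
  \<open>v = a s\<^sup>2\<close>; the coefficients are polynomials in \<open>-v\<close> formed from the \<open>S\<^sub>3(k+2j,j)\<close>, and their
  nonnegativity gives a majorant for the remainder. The half-line Gaussian moments then turn the
  terms into \<open>A\<^sub>k(0)\<close> (even moments) and \<open>B\<^sub>k(0)\<close> (odd moments). In the sum over both segments the
  odd moments cancel, so \<open>\<Gamma>(a)\<close> involves only the \<open>A\<^sub>k(0)\<close>, and the quotient \<open>Q(a,a)\<close> leads to
  \<open>1/2\<close> and the quotient of the two power series.
\<close>

subsection \<open>The values of the polynomials at zero\<close>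

text \<open>Differentiation lowers the truncation order of the exponential series by one, which
  brings back the term t^2/2.\<close>

lemma fps_deriv_exp_tail3:
  "fps_deriv (exp_tail3 :: complex fps) = exp_tail3 + fps_const (1/2) * fps_X ^ 2"
proof (rule fps_ext)
  fix n
  have "of_nat (Suc n) / fact (Suc n) = (1 / fact n :: complex)"
    by (simp del: of_nat_Suc)
  moreover have "n = 0 \<or> n = 1 \<or> n = 2 \<or> n \<ge> 3" by linarith
  ultimately show "fps_deriv (exp_tail3 :: complex fps) $ n = (exp_tail3 + fps_const (1/2) * fps_X ^ 2) $ n"
    by (auto simp: exp_tail3_def fact_numeral simp del: of_nat_Suc)
qed

text \<open>Comparison of coefficients in (f^(j+1))' = (j+1) f^j (f + t^2/2) with f =
  \<open>exp_tail3\<close>. In set partitions: the last of n + 3 elements joins one of the j + 1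
  blocks of the others, or forms a block of size 3 with two of them.\<close>

lemma stirling3_Suc:
  "stirling3 (n + 3) (Suc j) =
     of_nat (Suc j) * stirling3 (n + 2) (Suc j) + of_nat ((n + 2) choose 2) * stirling3 n j"
proof -
  let ?f = "exp_tail3 :: complex fps"
  have "fps_deriv (?f ^ Suc j) $ (n + 2) =
          (fps_const (of_nat (Suc j)) * (?f ^ Suc j + fps_const (1/2) * (fps_X ^ 2 * ?f ^ j))) $ (n + 2)"
    by (subst fps_deriv_power, subst fps_deriv_exp_tail3) (simp only: power_Suc diff_Suc_1 ring_distribs mult_ac)
  hence *: "of_nat (n + 3) * (?f ^ Suc j) $ (n + 3) =
           of_nat (Suc j) * ((?f ^ Suc j) $ (n + 2) + (?f ^ j) $ n / 2)"
    by (simp add: fps_X_power_mult_nth numeral_3_eq_3 del: power_Suc of_nat_Suc)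
  have "fact (n + 3) = (fact (n + 2) * of_nat (n + 3) :: complex)"
    by (simp add: numeral_eq_Suc algebra_simps)
  hence "stirling3 (n + 3) (Suc j) =
          fact (n + 2) / fact (Suc j) * (of_nat (n + 3) * (?f ^ Suc j) $ (n + 3))"
    by (simp add: stirling3_altdef)
  also have "\<dots> = of_nat (Suc j) * stirling3 (n + 2) (Suc j) +
               fact (n + 2) / fact (Suc j) * (of_nat (Suc j) * ((?f ^ j) $ n / 2))"
    by (simp only: * stirling3_altdef) (simp add: algebra_simps del: power_Suc of_nat_Suc)
  also have "fact (n + 2) / fact (Suc j) * (of_nat (Suc j) * ((?f ^ j) $ n / 2)) =
               of_nat ((n + 2) choose 2) * stirling3 n j"
  proof -
    have "of_nat ((n + 2) choose 2) = (fact (n + 2) / (2 * fact n) :: complex)"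
      by (subst binomial_fact) (auto simp: field_simps)
    thus ?thesis
      by (simp add: stirling3_altdef field_simps del: of_nat_Suc)
  qed
  finally show ?thesis .
qed

text \<open>The numbers S_3(k+2j, j). On this diagonal both terms on the right of
  \<open>stirling3_Suc\<close> belong to row k when the left side belongs to row k + 1. The values
  are natural numbers, and this nonnegativity later gives the majorant.\<close>

fun stirling3_diag :: "nat \<Rightarrow> nat \<Rightarrow> nat" where
  "stirling3_diag k 0 = (if k = 0 then 1 else 0)"
| "stirling3_diag 0 (Suc j) = 0"
| "stirling3_diag (Suc k) (Suc j) =
     Suc j * stirling3_diag k (Suc j) + ((k + 2 * j + 2) choose 2) * stirling3_diag k j"

lemma stirling3_diag: "stirling3 (k + 2 * j) j = of_nat (stirling3_diag k j)"
proof (induction k j rule: stirling3_diag.induct)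
  case (1 k)
  then show ?case by (simp add: stirling3_0_right)
next
  case (2 j)
  then show ?case by (simp add: stirling3_eq_0)
next
  case (3 k j)
  have "stirling3 (Suc k + 2 * Suc j) (Suc j) = stirling3 ((k + 2 * j) + 3) (Suc j)"
       "k + 2 * j + 2 = k + 2 * Suc j"
    by (simp_all add: numeral_3_eq_3)
  with 3 show ?case
    by (simp only: stirling3_Suc stirling3_diag.simps of_nat_add of_nat_mult)
qed

section \<open>Values at zero in terms of double factorials\<close>

lemma chi_rec_0_Suc_Suc:
  "poly (chi_rec u v (Suc (Suc k))) 0 = poly (chi_rec u v k) 0 / of_nat (Suc k)"
  by simp

fun dfact :: "nat \<Rightarrow> nat" where
  "dfact 0 = 1" | "dfact (Suc 0) = 1" | "dfact (Suc (Suc n)) = Suc (Suc n) * dfact n"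

text \<open>At zero the recurrence links only indices of equal parity. One starting value is zero,
  so one parity vanishes; along the other each step divides by the index, which builds up the double
  factorial \<open>dfact\<close>.\<close>

lemma poly_p_poly_0: "poly (p_poly n) 0 = (if even n then 1 / of_nat (dfact n) else 0)"
  unfolding p_poly_def
  by (induction n rule: dfact.induct)
     (auto simp del: of_nat_Suc mult_Suc chi_rec.simps(3) simp: chi_rec_0_Suc_Suc)

lemma poly_q_poly_0: "poly (q_poly n) 0 = (if odd n then - 1 / of_nat (dfact n) else 0)"
  unfolding q_poly_def
  by (induction n rule: dfact.induct)
     (auto simp del: of_nat_Suc mult_Suc chi_rec.simps(3) simp: chi_rec_0_Suc_Suc)

text \<open>All indices k + 2j have the parity of k, so the sum vanishes as a whole or no parity
  condition remains inside it.\<close>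

lemma poly_A_poly_0:
  "poly (A_poly k) 0 =
     (if even k then \<Sum>j\<le>k. (-1) ^ j * of_nat (stirling3_diag k j) / of_nat (dfact (k + 2 * j)) else 0)"
  by (auto simp: A_poly_def poly_sum poly_p_poly_0 stirling3_diag intro!: sum.cong)

lemma poly_B_poly_0:
  "poly (B_poly k) 0 =
     (if odd k then - (\<Sum>j\<le>k. (-1) ^ j * of_nat (stirling3_diag k j) / of_nat (dfact (k + 2 * j))) else 0)"
  by (auto simp: B_poly_def poly_sum poly_q_poly_0 stirling3_diag sum_negf[symmetric] intro!: sum.cong)

text \<open>The k-th coefficient of B = E A, solved for \<open>E_coeff k\<close>; the factor of
  \<open>E_coeff k\<close> is A_0(0) = 1.\<close>

lemma E_coeff_rec:
  "E_coeff k = poly (B_poly (2 * k + 1)) 0 - (\<Sum>i<k. E_coeff i * poly (A_poly (2 * (k - i))) 0)"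
proof -
  define A where "A = Abs_fps (\<lambda>i. poly (A_poly (2 * i)) 0)"
  define B where "B = Abs_fps (\<lambda>i. poly (B_poly (2 * i + 1)) 0)"
  have A0: "A $ 0 = 1"
    by (simp add: A_def A_B_poly_examples)
  have E: "E_coeff i = (B / A) $ i" for i
    by (simp add: E_coeff_def A_def B_def)
  have "B = B / A * A"
    using A0 by (simp add: fps_divide_unit inverse_mult_eq_1 mult.assoc)
  hence "B $ k = (\<Sum>i=0..k. E_coeff i * A $ (k - i))"
    by (metis (no_types, lifting) E fps_mult_nth sum.cong)
  also have "{0..k} = insert k {..<k}" by auto
  finally show ?thesis
    by (simp add: A0) (simp add: A_def B_def)
qed

text \<open>
  Tabulating row by row avoids the exponential recursion tree of \<^const>\<open>stirling3_diag\<close>.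
\<close>
fun next_diag_row :: "nat \<Rightarrow> nat \<Rightarrow> nat list \<Rightarrow> nat list" where
  "next_diag_row k j [] = []"
| "next_diag_row k j [x] = [(k + 2 * j + 2) * (k + 2 * j + 1) div 2 * x]"
| "next_diag_row k j (x # y # xs) =
     ((j + 1) * y + (k + 2 * j + 2) * (k + 2 * j + 1) div 2 * x) # next_diag_row k (j + 1) (y # xs)"

fun diag_row :: "nat \<Rightarrow> nat list" where
  "diag_row 0 = [1]"
| "diag_row (Suc k) = 0 # next_diag_row k 0 (diag_row k)"

lemma stirling3_diag_eq_0: "j > k \<Longrightarrow> stirling3_diag k j = 0"
  by (induction k j rule: stirling3_diag.induct) auto

text \<open>The list argument is row k from column j on. The one-element clause is the column j = k,
  whose right neighbour \<open>stirling3_diag k (k + 1)\<close> is zero.\<close>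

lemma next_diag_row:
  "j \<le> k \<Longrightarrow> next_diag_row k j (map (stirling3_diag k) [j..<Suc k]) =
    map (stirling3_diag (Suc k)) [Suc j..<Suc (Suc k)]"
proof (induction "k - j" arbitrary: j)
  case 0
  hence "j = k" by simp
  thus ?case
    by (simp add: stirling3_diag_eq_0 choose_two algebra_simps)
next
  case (Suc d)
  hence "[j..<Suc k] = j # Suc j # [Suc (Suc j)..<Suc k]" "[Suc j..<Suc k] = Suc j # [Suc (Suc j)..<Suc k]"
    by (simp_all add: upt_conv_Cons del: upt_Suc)
  moreover have "[Suc j..<Suc (Suc k)] = Suc j # [Suc (Suc j)..<Suc (Suc k)]"
    using Suc by (simp add: upt_conv_Cons del: upt_Suc)
  moreover have "next_diag_row k (Suc j) (map (stirling3_diag k) [Suc j..<Suc k]) =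
    map (stirling3_diag (Suc k)) [Suc (Suc j)..<Suc (Suc k)]"
    using Suc by simp
  ultimately show ?case
    by (simp add: choose_two algebra_simps del: upt_Suc)
qed

lemma diag_row: "diag_row k = map (stirling3_diag k) [0..<Suc k]"
proof (induction k)
  case (Suc k)
  thus ?case
    using next_diag_row[of 0 k] by (simp add: upt_conv_Cons del: upt_Suc)
qed auto

text \<open>The argument d carries the current denominator: started at the double factorial of n, it
  runs through those of n + 2, n + 4 and so on, each obtained from the one before.\<close>

fun alt_sum :: "nat \<Rightarrow> nat \<Rightarrow> nat list \<Rightarrow> complex" where
  "alt_sum n d [] = 0"
| "alt_sum n d (x # xs) = of_nat x / of_nat d - alt_sum (n + 2) (d * (n + 2)) xs"

lemma alt_sum_diag:
  "j \<le> Suc k \<Longrightarrow> (-1) ^ j * alt_sum (k + 2 * j) (dfact (k + 2 * j)) (map (stirling3_diag k) [j..<Suc k]) =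
     (\<Sum>i=j..k. (-1) ^ i * of_nat (stirling3_diag k i) / of_nat (dfact (k + 2 * i)))"
proof (induction "Suc k - j" arbitrary: j)
  case (Suc d)
  hence "[j..<Suc k] = j # [Suc j..<Suc k]" "{j..k} = insert j {Suc j..k}"
    by (auto simp: upt_conv_Cons simp del: upt_Suc)
  moreover have "k + 2 * Suc j = Suc (Suc (k + 2 * j))" by simp
  moreover have "(\<Sum>i=Suc j..k. (-1) ^ i * of_nat (stirling3_diag k i) / of_nat (dfact (k + 2 * i))) =
    (-1) ^ Suc j * alt_sum (k + 2 * Suc j) (dfact (k + 2 * Suc j)) (map (stirling3_diag k) [Suc j..<Suc k])"
    using Suc by (intro Suc.hyps [symmetric]) auto
  ultimately show ?case
    by (simp add: algebra_simps del: upt_Suc of_nat_Suc)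
qed auto

lemma alt_sum_diag_row:
  "alt_sum k (dfact k) (diag_row k) =
     (\<Sum>j\<le>k. (-1) ^ j * of_nat (stirling3_diag k j) / of_nat (dfact (k + 2 * j)))"
  using alt_sum_diag[of 0 k] unfolding diag_row by (simp add: atLeast0AtMost del: upt_Suc)

lemma poly_A_poly_0_eq_alt_sum: "even k \<Longrightarrow> poly (A_poly k) 0 = alt_sum k (dfact k) (diag_row k)"
  and poly_B_poly_0_eq_alt_sum: "odd k \<Longrightarrow> poly (B_poly k) 0 = - alt_sum k (dfact k) (diag_row k)"
  by (simp_all add: poly_A_poly_0 poly_B_poly_0 alt_sum_diag_row)

section \<open>Evaluation of the first coefficients\<close>

lemma diag_row_numeral:
  "diag_row (numeral k) = 0 # next_diag_row (pred_numeral k) 0 (diag_row (pred_numeral k))"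
  by (simp add: numeral_eq_Suc)

text \<open>The two binary forms are the numerals from 2 upwards, so rewriting with these equations
  stops at 0 or 1.\<close>

lemma dfact_numeral:
  "dfact (numeral (num.Bit0 n)) = numeral (num.Bit0 n) * dfact (numeral (num.Bit0 n) - 2)"
  "dfact (numeral (num.Bit1 n)) = numeral (num.Bit1 n) * dfact (numeral (num.Bit1 n) - 2)"
proof -
  have *: "dfact m = m * dfact (m - 2)" if "m \<ge> 2" for m
    using that by (cases m rule: dfact.cases) auto
  show "dfact (numeral (num.Bit0 n)) = numeral (num.Bit0 n) * dfact (numeral (num.Bit0 n) - 2)"
  "dfact (numeral (num.Bit1 n)) = numeral (num.Bit1 n) * dfact (numeral (num.Bit1 n) - 2)"
    by (rule *; simp)+
qed

lemma poly_A_poly_0_values: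
  "poly (A_poly 2) 0 = 1 / 12"
  "poly (A_poly 4) 0 = 1 / 288"
  "poly (A_poly 6) 0 = - 139 / 51840"
  "poly (A_poly 8) 0 = - 571 / 2488320"
  "poly (A_poly 10) 0 = 163879 / 209018880"
  "poly (A_poly 12) 0 = 5246819 / 75246796800"
  "poly (A_poly 14) 0 = - 534703531 / 902961561600"
  by (simp_all add: poly_A_poly_0_eq_alt_sum diag_row_numeral dfact_numeral)

lemma poly_B_poly_0_values:
  "poly (B_poly (Suc 0)) 0 = 1 / 3"
  "poly (B_poly 3) 0 = 4 / 135"
  "poly (B_poly 5) 0 = - 8 / 2835"
  "poly (B_poly 7) 0 = - 16 / 8505"
  "poly (B_poly 9) 0 = 8992 / 12629925"
  "poly (B_poly 11) 0 = 334144 / 492567075"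
  "poly (B_poly 13) 0 = - 698752 / 1477701225"
  "poly (B_poly 15) 0 = - 23349012224 / 39565450299375"
  by (simp_all add: poly_B_poly_0_eq_alt_sum diag_row_numeral dfact_numeral)

lemma E_coeff_values:
  "E_coeff 0 = 1 / 3"
  "E_coeff (Suc 0) = 1 / 540"
  "E_coeff 2 = - 25 / 6048"
  "E_coeff 3 = - 101 / 155520"
  "E_coeff 4 = 3184811 / 3695155200"
  "E_coeff 5 = 2745493 / 8151736320"
  "E_coeff 6 = - 119937661 / 225740390400"
  "E_coeff 7 = - 8325705316049 / 24176795811840000"
proof -
  note s = lessThan_nat_numeral lessThan_Suc pred_numeral_simps poly_A_poly_0_values poly_B_poly_0_values
  show e0: "E_coeff 0 = 1 / 3"
    by (subst E_coeff_rec) (simp add: s)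
  show e1: "E_coeff (Suc 0) = 1 / 540"
    by (subst E_coeff_rec) (simp add: s e0)
  show e2: "E_coeff 2 = - 25 / 6048"
    by (subst E_coeff_rec) (simp add: s e0 e1)
  show e3: "E_coeff 3 = - 101 / 155520"
    by (subst E_coeff_rec) (simp add: s e0 e1 e2)
  show e4: "E_coeff 4 = 3184811 / 3695155200"
    by (subst E_coeff_rec) (simp add: s e0 e1 e2 e3)
  show e5: "E_coeff 5 = 2745493 / 8151736320"
    by (subst E_coeff_rec) (simp add: s e0 e1 e2 e3 e4)
  show e6: "E_coeff 6 = - 119937661 / 225740390400"
    by (subst E_coeff_rec) (simp add: s e0 e1 e2 e3 e4 e5)
  show e7: "E_coeff 7 = - 8325705316049 / 24176795811840000"
    by (subst E_coeff_rec) (simp add: s e0 e1 e2 e3 e4 e5 e6)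
qed

subsection \<open>Asymptotic quotients of power series\<close>

text \<open>With x = 1/a the truncated series are polynomials in x. The difference of B and A (B/A),
  after truncation, has no coefficient up to degree m, hence is x^(m+1) times a polynomial
  \<open>R\<close>; the quotient of \<open>R\<close> by the truncation of A is bounded near x = 0
  because A has nonzero constant term.\<close>

lemma fps_quotient_asymp:
  fixes A B :: "complex fps"
  assumes A0: "A $ 0 \<noteq> 0"
  shows "(\<lambda>a. (\<Sum>k\<le>m. B $ k / a ^ k) / (\<Sum>k\<le>m. A $ k / a ^ k) - (\<Sum>k\<le>m. (B / A) $ k / a ^ k))
           \<in> O[at_infinity](\<lambda>a. 1 / a ^ (m + 1))"
proof -
  define p where "p C = (\<Sum>k\<le>m. monom (C $ k) k)" for C :: "complex fps"
  have coeff_p: "coeff (p C) i = (if i \<le> m then C $ i else 0)" for C i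
    by (simp add: p_def coeff_sum)
  have poly_p: "poly (p C) (inverse a) = (\<Sum>k\<le>m. C $ k / a ^ k)" for C a
    by (simp add: p_def poly_sum poly_monom divide_inverse power_inverse)
  have "B = A * (B / A)"
    using A0 by (simp add: fps_divide_unit inverse_mult_eq_1' mult.left_commute)
  hence "coeff (p B - p A * p (B / A)) i = 0" if "i \<le> m" for i
    using that by (auto simp: coeff_mult coeff_p fps_mult_nth atLeast0AtMost dest!: fps_eq_iff [THEN iffD1, rule_format, of _ _ i] intro!: sum.cong)
  hence "monom 1 (m + 1) dvd p B - p A * p (B / A)"
    by (simp add: monom_1_dvd_iff')
  then obtain R where R: "p B - p A * p (B / A) = monom 1 (m + 1) * R"
    by (elim dvdE)
  have lim: "((\<lambda>a. poly C (inverse a)) \<longlongrightarrow> poly C 0) at_infinity" for C :: "complex poly"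
    by (rule isCont_tendsto_compose [OF _ tendsto_inverse_0]) (intro continuous_intros)
  have A_0: "poly (p A) 0 \<noteq> 0"
    using A0 by (simp add: poly_0_coeff_0 coeff_p)
  have ev: "eventually (\<lambda>a. poly (p A) (inverse a) \<noteq> 0) at_infinity"
    using tendsto_imp_eventually_ne [OF lim A_0] .
  have "(\<lambda>a. poly R (inverse a) / poly (p A) (inverse a)) \<in> O[at_infinity](\<lambda>_. 1)"
    using tendsto_divide [OF lim [of R] lim [of "p A"] A_0] by (intro bigoI_tendsto) simp_all
  hence "(\<lambda>a. 1 / a ^ (m + 1) * (poly R (inverse a) / poly (p A) (inverse a))) \<in> O[at_infinity](\<lambda>a. 1 / a ^ (m + 1) * 1)"
    by (rule landau_o.big.mult [OF landau_o.big_refl])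
  also have "?this \<longleftrightarrow> ?thesis"
  proof (intro landau_o.big.cong_ex)
    show "\<forall>\<^sub>F a in at_infinity. 1 / a ^ (m + 1) * (poly R (inverse a) / poly (p A) (inverse a)) =
      (\<Sum>k\<le>m. B $ k / a ^ k) / (\<Sum>k\<le>m. A $ k / a ^ k) - (\<Sum>k\<le>m. (B / A) $ k / a ^ k)"
      using ev
    proof eventually_elim
      case (elim a)
      have "1 / a ^ (m + 1) * poly R (inverse a) = poly (p B - p A * p (B / A)) (inverse a)"
        unfolding R by (simp add: poly_monom divide_inverse power_inverse)
      thus ?case
        unfolding poly_p [symmetric] using elim by (simp add: field_simps)
    qed
  qed simp
  finally show ?thesis .
qed

text \<open>At the first index n where the sequences could differ, the difference of the partial
  sums is exactly (E n - F n) / a^n, which is of order a^(-n-1) only if the constant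
  vanishes.\<close>

lemma sum_power_inverse_bigo_unique:
  fixes E F :: "nat \<Rightarrow> complex"
  assumes "\<And>m. (\<lambda>a. (\<Sum>k\<le>m. E k / a ^ k) - (\<Sum>k\<le>m. F k / a ^ k)) \<in> O[at_infinity](\<lambda>a. 1 / a ^ (m + 1))"
  shows "E = F"
proof
  fix n
  show "E n = F n"
  proof (induction n rule: less_induct)
    case (less n)
    have eq: "(\<Sum>k\<le>n. E k / a ^ k) - (\<Sum>k\<le>n. F k / a ^ k) = (E n - F n) / a ^ n" for a
      using less by (simp add: lessThan_Suc_atMost [symmetric] diff_divide_distrib)
    have "(\<lambda>a. (E n - F n) / a ^ n) \<in> O[at_infinity](\<lambda>a. 1 / a ^ (n + 1))"
      using assms [of n] unfolding eq .
    hence "(\<lambda>a. a ^ n * ((E n - F n) / a ^ n)) \<in> O[at_infinity](\<lambda>a. a ^ n * (1 / a ^ (n + 1)))"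
      by (rule landau_o.big.mult [OF landau_o.big_refl])
    also have "?this \<longleftrightarrow> (\<lambda>_. E n - F n) \<in> O[at_infinity](\<lambda>a. 1 / a)"
      by (intro landau_o.big.cong_ex eventually_mono [OF eventually_not_equal_at_infinity [of 0]]) auto
    also have "(\<lambda>a. 1 / a) \<in> o[at_infinity](\<lambda>_. 1 :: complex)"
      by (rule smalloI_tendsto) (use tendsto_inverse_0 in \<open>simp_all add: divide_inverse\<close>)
    finally have "(\<lambda>_::complex. E n - F n) \<in> o[at_infinity](\<lambda>_. 1 :: complex)" .
    hence "((\<lambda>_::complex. E n - F n) \<longlongrightarrow> 0) at_infinity"
      by (auto dest: smalloD_tendsto)
    from tendsto_unique [OF trivial_limit_at_infinity tendsto_const this] show ?case
      by simp
  qed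
qed

subsection \<open>Laplace's method on a segment of steepest descent\<close>

text \<open>The value 11/4 makes e - 5/2 at most 1/4, half of the Gaussian exponent 1/2 that it has
  to compete with.\<close>

lemma exp_1_le: "exp (1 :: real) \<le> 11 / 4"
proof -
  \<comment> \<open>The bound 1 + x + x^2 gives only 3 at x = 1; taken at x = 1/64 and raised to the
    power 64 it gives about 2.74.\<close>
  have "exp (1 :: real) = exp (1 / 64) ^ 64"
    by (simp flip: exp_of_nat_mult)
  also have "exp (1 / 64 :: real) \<le> 1 + 1 / 64 + (1 / 64)\<^sup>2"
    by (rule exp_bound) auto
  hence "exp (1 / 64 :: real) ^ 64 \<le> (1 + 1 / 64 + (1 / 64)\<^sup>2) ^ 64"
    by (rule power_mono) auto
  also have "\<dots> \<le> 11 / 4"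
    by (simp add: field_simps)
  finally show ?thesis .
qed

text \<open>The series of (exp t - 1 - t - t^2/2) / t^2. Dividing by t^2 rather than t^3 leaves the
  factor v = a s^2 in the exponent, and the zero constant term allows substitution into
  \<open>fps_exp\<close>.\<close>

definition exp_tail3_quot :: "'a::field_char_0 fps" where
  "exp_tail3_quot = Abs_fps (\<lambda>n. if n = 0 then 0 else 1 / fact (n + 2))"

lemma exp_tail3_eq_X2_mult: "exp_tail3 = fps_X ^ 2 * exp_tail3_quot" (is "?L = ?R")
proof (rule fps_ext)
  fix n :: nat
  have "n = 0 \<or> n = 1 \<or> (\<exists>k. n = k + 2)" by presburger
  thus "?L $ n = ?R $ n"
    by (auto simp: exp_tail3_def exp_tail3_quot_def fps_X_power_mult_nth)
qed

lemma exp_tail3_eq_exp: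
  "exp_tail3 = fps_exp 1 - fps_of_poly [:1, 1, 1/2:]" (is "?L = ?R")
proof (rule fps_ext)
  fix n :: nat
  have "n = 0 \<or> n = 1 \<or> n = 2 \<or> n \<ge> 3" by linarith
  thus "?L $ n = ?R $ n"
    by (auto simp: exp_tail3_def coeff_pCons numeral_2_eq_2 split: nat.splits)
qed

text \<open>Each of the j factors loses t^2; this shift is the origin of the indices k + 2j in
  S_3(k+2j, j).\<close>

lemma exp_tail3_quot_power_nth:
  "(exp_tail3_quot ^ j :: complex fps) $ k = (exp_tail3 ^ j) $ (k + 2 * j)"
  unfolding exp_tail3_eq_X2_mult power_mult_distrib power_mult [symmetric]
  by (simp add: fps_X_power_mult_nth)

lemma fps_conv_radius_exp_tail3_quot [simp]: "fps_conv_radius (exp_tail3_quot :: complex fps) = \<infinity>"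
proof -
  have "(exp_tail3_quot :: complex fps) = fps_shift 2 (exp_tail3 :: complex fps)"
    by (simp add: exp_tail3_eq_X2_mult mult.commute)
  moreover have "fps_conv_radius (exp_tail3 :: complex fps) = \<infinity>"
    unfolding exp_tail3_eq_exp
    using fps_conv_radius_diff [of "fps_exp 1 :: complex fps" "fps_of_poly [:1, 1, 1/2:]"] by simp
  ultimately show ?thesis
    by (metis fps_conv_radius_shift)
qed

text \<open>The quotient (exp s - 1 - s - s^2/2) / s^2 with the removable singularity at 0 filled in
  by the power series.\<close>

definition exp_quot :: "complex \<Rightarrow> complex" where
  "exp_quot = eval_fps exp_tail3_quot"

lemma exp_quot: "s\<^sup>2 * exp_quot s = exp s - 1 - s - s\<^sup>2 / 2"
proof -
  have "s\<^sup>2 * exp_quot s = eval_fps (fps_X ^ 2 * exp_tail3_quot) s"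
    by (subst eval_fps_mult) (simp_all add: exp_quot_def)
  also have "\<dots> = eval_fps (fps_exp 1 - fps_of_poly [:1, 1, 1/2:]) s"
    unfolding exp_tail3_eq_X2_mult [symmetric] exp_tail3_eq_exp ..
  also have "\<dots> = exp s - 1 - s - s\<^sup>2 / 2"
    by (subst eval_fps_diff) (simp_all add: power2_eq_square algebra_simps)
  finally show ?thesis .
qed

text \<open>The coefficient of s^k in exp(v \<open>exp_quot\<close> s), as \<open>expc_sums\<close>
  shows. As a polynomial in v it has nonnegative coefficients, so its value at -v is dominated by
  that at v.\<close>

definition expc :: "real \<Rightarrow> nat \<Rightarrow> real" where
  "expc v k = (\<Sum>j\<le>k. of_nat (stirling3_diag k j) / fact (k + 2 * j) * v ^ j)"

lemma abs_expc_le: "v \<ge> 0 \<Longrightarrow> \<bar>expc (-v) k\<bar> \<le> expc v k"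
  unfolding expc_def
  by (rule order_trans [OF sum_abs]) (auto simp: abs_mult power_abs intro!: sum_mono)

lemma expc_nonneg: "v \<ge> 0 \<Longrightarrow> expc v k \<ge> 0"
  using abs_expc_le [of v k] by linarith

text \<open>The composition is entire, so its expansion at 0 converges for every s, and the
  composition formula for formal series identifies the coefficients.\<close>

lemma expc_sums: "(\<lambda>k. of_real (expc v k) * s ^ k) sums exp (of_real v * exp_quot s)"
proof -
  have 1: "(\<lambda>s. exp (of_real v * s)) has_fps_expansion fps_exp (of_real v :: complex)"
    by (intro fps_expansion_intros)
  have 2: "exp_quot has_fps_expansion exp_tail3_quot"
    unfolding exp_quot_def by (rule eval_fps_has_fps_expansion) simp
  have "((\<lambda>s. exp (of_real v * s)) \<circ> exp_quot) has_fps_expansion (fps_exp (of_real v) oo exp_tail3_quot)"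
    by (intro has_fps_expansion_compose 1 2) (simp add: exp_tail3_quot_def)
  moreover have "exp_quot holomorphic_on UNIV"
    unfolding exp_quot_def by (intro holomorphic_intros) auto
  hence "(\<lambda>s. exp (of_real v * s)) \<circ> exp_quot holomorphic_on eball 0 \<infinity>"
    unfolding o_def by (intro holomorphic_intros) (auto intro: holomorphic_on_subset)
  ultimately have "(\<lambda>k. (fps_exp (of_real v) oo exp_tail3_quot) $ k * s ^ k) sums
                     ((\<lambda>s. exp (of_real v * s)) \<circ> exp_quot) s"
    by (rule has_fps_expansion_imp_sums_complex) auto
  moreover have "(fps_exp (of_real v :: complex) oo exp_tail3_quot) $ k = of_real (expc v k)" for k
  proof -
    have "(fps_exp (of_real v :: complex) oo exp_tail3_quot) $ k =
            (\<Sum>j\<le>k. of_real v ^ j / fact j * (exp_tail3 ^ j) $ (k + 2 * j))"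
      by (simp add: fps_compose_nth exp_tail3_quot_power_nth atLeast0AtMost)
    also have "\<dots> = (\<Sum>j\<le>k. stirling3 (k + 2 * j) j / fact (k + 2 * j) * of_real v ^ j)"
      by (intro sum.cong) (simp_all add: stirling3_altdef)
    finally show ?thesis
      by (simp add: stirling3_diag expc_def)
  qed
  ultimately show ?thesis
    by (simp add: o_def)
qed

text \<open>The case s = 1. For v at least 0 the terms are nonnegative, so this value bounds every
  partial sum and every tail.\<close>

lemma expc_sums_exp: "expc v sums exp (v * (exp 1 - 5 / 2))"
proof -
  have "exp_quot 1 = of_real (exp 1 - 5 / 2)"
    using exp_quot [of 1] by (simp add: field_simps exp_of_real [symmetric])
  hence "(\<lambda>k. of_real (expc v k) * 1 ^ k) sums (of_real (exp (v * (exp 1 - 5 / 2))) :: complex)"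
    using expc_sums [of v 1] by (simp add: exp_of_real [symmetric])
  thus ?thesis
    by (simp add: sums_of_real_iff)
qed

lemma sum_expc_le:
  assumes "v \<ge> 0"
  shows "(\<Sum>k\<in>A. expc v k) \<le> exp (v * (exp 1 - 5 / 2))"
proof (cases "finite A")
  case True
  thus ?thesis
    using sum_le_suminf [of "expc v" A] expc_sums_exp [of v] expc_nonneg [OF assms]
    by (auto simp: sums_iff)
qed auto

text \<open>For k at least M the power |s|^k is at most |s|^M, so the tail is dominated termwise by
  |s|^M times the tail of the majorant series at 1.\<close>

lemma norm_exp_exp_quot_remainder_le:
  assumes v: "v \<ge> 0" and s: "norm s \<le> 1"
  shows "norm (exp (- of_real v * exp_quot s) - (\<Sum>k<M. of_real (expc (-v) k) * s ^ k))
           \<le> norm s ^ M * exp (v * (exp 1 - 5 / 2))"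
proof -
  define f where "f = (\<lambda>k. of_real (expc (-v) k) * s ^ k)"
  define g where "g = (\<lambda>k. norm s ^ M * expc v (k + M))"
  have f: "(\<lambda>k. f (k + M)) sums (exp (- of_real v * exp_quot s) - (\<Sum>k<M. f k))"
    using expc_sums [of "-v" s] unfolding f_def by (intro sums_split_initial_segment) auto
  have g: "g sums (norm s ^ M * (exp (v * (exp 1 - 5 / 2)) - (\<Sum>k<M. expc v k)))"
    unfolding g_def by (intro sums_mult sums_split_initial_segment expc_sums_exp)
  have "norm (f (k + M)) \<le> g k" for k
  proof -
    have "norm (f (k + M)) \<le> expc v (k + M) * (norm s ^ k * norm s ^ M)"
      unfolding f_def norm_mult norm_power power_add [symmetric]
      by (intro mult_right_mono) (use abs_expc_le [OF v] in auto)
    also have "\<dots> \<le> expc v (k + M) * (1 * norm s ^ M)"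
      using s by (intro mult_left_mono mult_right_mono power_le_one expc_nonneg v) auto
    finally show ?thesis by (simp add: g_def mult_ac)
  qed
  hence "norm (exp (- of_real v * exp_quot s) - (\<Sum>k<M. f k)) \<le>
           norm s ^ M * (exp (v * (exp 1 - 5 / 2)) - (\<Sum>k<M. expc v k))"
    using f g norm_suminf_le [of "\<lambda>k. f (k + M)" g] by (auto simp: sums_iff)
  also have "\<dots> \<le> norm s ^ M * exp (v * (exp 1 - 5 / 2))"
    using expc_nonneg [OF v] by (intro mult_left_mono) (auto intro: sum_nonneg)
  finally show ?thesis unfolding f_def .
qed

text \<open>Outside the unit disc |s|^k is at most |s|^M for k < M. The truncated expansion thus
  obeys the bound of the remainder there, which permits integrating it over the whole
  half-line.\<close>

lemma norm_sum_expc_le: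
  fixes s :: complex
  assumes v: "v \<ge> 0" and s: "norm s \<ge> 1"
  shows "norm (\<Sum>k<M. of_real (expc (-v) k) * s ^ k) \<le> norm s ^ M * exp (v * (exp 1 - 5 / 2))"
proof -
  have "norm (\<Sum>k<M. of_real (expc (-v) k) * s ^ k) \<le> (\<Sum>k<M. expc v k * norm s ^ M)"
  proof (rule sum_norm_le)
    fix k assume "k \<in> {..<M}"
    thus "norm (of_real (expc (-v) k) * s ^ k) \<le> expc v k * norm s ^ M"
      unfolding norm_mult norm_power
      by (intro mult_mono) (use s abs_expc_le [OF v] expc_nonneg [OF v] in \<open>auto intro: power_increasing\<close>)
  qed
  also have "\<dots> \<le> exp (v * (exp 1 - 5 / 2)) * norm s ^ M"
    unfolding sum_distrib_right [symmetric] by (intro mult_right_mono sum_expc_le v) auto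
  finally show ?thesis by (simp add: mult_ac)
qed

section \<open>Half-line Gaussian moments and the coefficients of the expansion\<close>

lemma gaussian_moment_scaled:
  fixes c :: real
  assumes c: "c > 0" and "has_bochner_integral lborel (\<lambda>x. indicator {0..} x *\<^sub>R (exp (- x\<^sup>2) * x ^ n)) I"
  shows "((\<lambda>x. exp (- (x / c)\<^sup>2) * x ^ n) has_integral c ^ (n + 1) * I) {0..}"
proof -
  have "has_bochner_integral lborel (\<lambda>x. c ^ n * (indicator {0..} (x / c) *\<^sub>R (exp (- (x / c)\<^sup>2) * (x / c) ^ n))) (c ^ n * (c * I))"
  proof (intro has_bochner_integral_mult_right)
    show "has_bochner_integral lborel (\<lambda>x. indicator {0..} (x / c) *\<^sub>R (exp (- (x / c)\<^sup>2) * (x / c) ^ n)) (c * I)"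
      using c assms(2) lborel_has_bochner_integral_real_affine_iff [of "1 / c" "\<lambda>x. indicator {0..} x *\<^sub>R (exp (- x\<^sup>2) * x ^ n)" I 0]
      by (simp add: mult.commute)
  qed
  also have "(\<lambda>x. c ^ n * (indicator {0..} (x / c) *\<^sub>R (exp (- (x / c)\<^sup>2) * (x / c) ^ n))) =
    (\<lambda>x. if x \<in> {0..} then exp (- (x / c)\<^sup>2) * x ^ n else 0)"
    using c by (auto simp: fun_eq_iff indicator_def zero_le_divide_iff power_divide)
  finally have "((\<lambda>x. if x \<in> {0..} then exp (- (x / c)\<^sup>2) * x ^ n else 0) has_integral (c ^ n * (c * I))) UNIV"
    unfolding has_bochner_integral_iff
    using has_integral_integral_lborel [of "\<lambda>x. if x \<in> {0..} then exp (- (x / c)\<^sup>2) * x ^ n else 0"] by metis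
  thus ?thesis
    unfolding has_integral_restrict_UNIV by (simp add: mult_ac)
qed

lemma dfact_even: "dfact (2 * n) = 2 ^ n * fact n"
  and dfact_odd: "dfact (2 * n + 1) * (2 ^ n * fact n) = fact (2 * n + 1)"
proof -
  show "dfact (2 * n) = 2 ^ n * fact n"
    by (induction n) (auto simp: algebra_simps)
  show "dfact (2 * n + 1) * (2 ^ n * fact n) = fact (2 * n + 1)"
  proof (induction n)
    case (Suc n)
    have "dfact (2 * Suc n + 1) * (2 ^ Suc n * fact (Suc n)) =
            (2 * n + 3) * (2 * n + 2) * (dfact (2 * n + 1) * (2 ^ n * fact n))"
      by (simp add: algebra_simps)
    also have "\<dots> = fact (2 * Suc n + 1)"
      unfolding Suc.IH by (simp add: algebra_simps)
    finally show ?case .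
  qed auto
qed

lemma dfact_pos: "dfact n > 0"
  by (induction n rule: dfact.induct) auto

text \<open>The moments for exp(-x^2), rescaled by sqrt 2. The quotient n!/n!! is the double
  factorial of n - 1; this form also covers n = 0, and its numerator cancels the factorial in
  \<open>expc\<close>.\<close>

lemma half_gaussian_moment:
  "((\<lambda>x. exp (- x\<^sup>2 / 2) * x ^ n) has_integral
      (if even n then sqrt (pi / 2) else 1) * fact n / dfact n) {0..}"
proof (cases "even n")
  case True
  then obtain k where k: "n = 2 * k" by (elim evenE)
  have "sqrt 2 ^ (n + 1) = sqrt 2 * (sqrt 2 ^ 2) ^ k"
    unfolding k power_mult [symmetric] by simp
  hence "sqrt 2 ^ (n + 1) * (sqrt pi / 2 * (fact n / (2 ^ n * fact k))) = sqrt (pi / 2) * fact n / dfact n"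
    unfolding k dfact_even by (simp add: real_sqrt_divide field_simps power_mult power2_eq_square)
  thus ?thesis
    using gaussian_moment_scaled [OF _ gaussian_moment_even_pos [of k], of "sqrt 2"] True
    unfolding k by (simp add: power_divide)
next
  case False
  then obtain k where k: "n = 2 * k + 1" by (elim oddE)
  have "real (fact n) = real (dfact n) * (2 ^ k * fact k)"
    unfolding k dfact_odd [of k, symmetric] by simp
  moreover have "sqrt 2 ^ (n + 1) = (sqrt 2 ^ 2) ^ (k + 1)"
    unfolding k power_mult [symmetric] by simp
  ultimately have "sqrt 2 ^ (n + 1) * (fact k / 2) = fact n / dfact n"
    using dfact_pos [of n] by (simp add: field_simps)
  thus ?thesis
    using gaussian_moment_scaled [OF _ gaussian_moment_odd_pos [of k], of "sqrt 2"] False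
    unfolding k by (simp add: power_divide)
qed

definition laplace_coeff :: "nat \<Rightarrow> real" where
  "laplace_coeff k = (if even k then sqrt (pi / 2) else 1) *
     (\<Sum>j\<le>k. (-1) ^ j * of_nat (stirling3_diag k j) / of_nat (dfact (k + 2 * j)))"

text \<open>Term by term the factorial of k + 2j cancels against the moment. What remains is the
  reciprocal double factorial, up to sign the value at zero of \<open>p_poly\<close> or
  \<open>q_poly\<close>.\<close>

lemma laplace_coeff_integral:
  "((\<lambda>y. exp (- y\<^sup>2 / 2) * (expc (- y\<^sup>2) k * y ^ k)) has_integral laplace_coeff k) {0..}"
proof -
  have "((\<lambda>y. \<Sum>j\<le>k. (-1) ^ j * of_nat (stirling3_diag k j) / fact (k + 2 * j) *
             (exp (- y\<^sup>2 / 2) * y ^ (k + 2 * j))) has_integral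
          (\<Sum>j\<le>k. (-1) ^ j * of_nat (stirling3_diag k j) / fact (k + 2 * j) *
             ((if even (k + 2 * j) then sqrt (pi / 2) else 1) * fact (k + 2 * j) / dfact (k + 2 * j)))) {0..}"
    by (intro has_integral_sum has_integral_mult_right half_gaussian_moment) auto
  also have "(\<Sum>j\<le>k. (-1) ^ j * of_nat (stirling3_diag k j) / fact (k + 2 * j) *
             ((if even (k + 2 * j) then sqrt (pi / 2) else 1) * fact (k + 2 * j) / dfact (k + 2 * j))) =
               laplace_coeff k"
    unfolding laplace_coeff_def sum_distrib_left by (intro sum.cong) auto
  also have "(\<lambda>y. \<Sum>j\<le>k. (-1) ^ j * of_nat (stirling3_diag k j) / fact (k + 2 * j) *
             (exp (- y\<^sup>2 / 2) * y ^ (k + 2 * j))) =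
             (\<lambda>y::real. exp (- y\<^sup>2 / 2) * (expc (- y\<^sup>2) k * y ^ k))"
    unfolding expc_def sum_distrib_left sum_distrib_right
    by (intro ext sum.cong) (auto simp: power_add power_mult power_minus [of "_\<^sup>2"])
  finally show ?thesis .
qed

text \<open>One of the two terms vanishes according to the parity of k.\<close>

lemma laplace_coeff: "of_real (laplace_coeff k) = of_real (sqrt (pi / 2)) * poly (A_poly k) 0 - poly (B_poly k) 0"
  by (simp add: laplace_coeff_def poly_A_poly_0 poly_B_poly_0)

lemma power_mult_gaussian_integrable: "(\<lambda>y::real. y ^ M * exp (- y\<^sup>2 / 4)) integrable_on {0..}"
proof -
  have "\<exists>I. has_bochner_integral lborel (\<lambda>x::real. indicator {0..} x *\<^sub>R (exp (- x\<^sup>2) * x ^ M)) I"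
    using gaussian_moment_even_pos [of "M div 2"] gaussian_moment_odd_pos [of "M div 2"]
    by (cases "even M") (auto elim!: evenE oddE)
  thus ?thesis
    using gaussian_moment_scaled [of 2] by (auto simp: power_divide integrable_on_def mult.commute)
qed

definition psi :: "complex \<Rightarrow> complex" where
  "psi s = exp s - 1 - s"

text \<open>On s = y \<epsilon> with y real, psi(s)/\<epsilon>^2 equals y^2/2 + y^2
  \<open>exp_quot\<close> s, a real Gaussian exponent plus a perturbation. The constant depends on M
  alone, so the bound is uniform in the direction of \<epsilon>; this yields uniformity in the
  sector.\<close>

lemma laplace_expansion:
  fixes M :: nat
  shows "\<exists>C. \<forall>\<epsilon> F. \<epsilon> \<noteq> 0 \<longrightarrow> (\<forall>s. (F has_field_derivative exp (- psi s / \<epsilon>\<^sup>2)) (at s)) \<longrightarrow>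
           norm (F (\<epsilon> / of_real (norm \<epsilon>)) - F 0 - (\<Sum>k<M. of_real (laplace_coeff k) * \<epsilon> ^ (k + 1)))
             \<le> C * norm \<epsilon> ^ (M + 1)"
proof -
  define C where "C = integral {0..} (\<lambda>y::real. y ^ M * exp (- y\<^sup>2 / 4))"
  have "norm (F (\<epsilon> / of_real (norm \<epsilon>)) - F 0 - (\<Sum>k<M. of_real (laplace_coeff k) * \<epsilon> ^ (k + 1)))
             \<le> C * norm \<epsilon> ^ (M + 1)"
    if eps: "\<epsilon> \<noteq> 0" and F: "\<And>s. (F has_field_derivative exp (- psi s / \<epsilon>\<^sup>2)) (at s)" for \<epsilon> F
  proof -
    \<comment> \<open>The parameter at which s = y \<epsilon> reaches the unit circle.\<close>
    define R where "R = 1 / norm \<epsilon>"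
    have R: "R > 0" using eps by (simp add: R_def)
    define f where "f y = exp (- psi (of_real y * \<epsilon>) / \<epsilon>\<^sup>2)" for y :: real
    \<comment> \<open>The truncated expansion is integrated over all y at least 0 although the
      segment stops at \<open>R\<close>; the excess is part of the error.\<close>
    define h where "h y = (\<Sum>k<M. \<epsilon> ^ k * of_real (exp (- y\<^sup>2 / 2) * (expc (- y\<^sup>2) k * y ^ k)))" for y :: real
    have f_eq: "f y = of_real (exp (- y\<^sup>2 / 2)) * exp (- of_real (y\<^sup>2) * exp_quot (of_real y * \<epsilon>))" for y
    proof -
      have "psi (of_real y * \<epsilon>) = (of_real y * \<epsilon>)\<^sup>2 / 2 + (of_real y * \<epsilon>)\<^sup>2 * exp_quot (of_real y * \<epsilon>)"
        unfolding exp_quot psi_def by simp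
      hence "- psi (of_real y * \<epsilon>) / \<epsilon>\<^sup>2 =
               - (of_real y)\<^sup>2 / 2 + - (of_real y)\<^sup>2 * exp_quot (of_real y * \<epsilon>)"
        using eps by (simp add: field_simps)
      thus ?thesis
        by (simp only: f_def exp_add) (simp add: exp_of_real [symmetric])
    qed
    have "((\<lambda>z. F (z * \<epsilon>) / \<epsilon>) has_field_derivative exp (- psi (z * \<epsilon>) / \<epsilon>\<^sup>2)) (at z)" for z
      using eps by (auto intro!: derivative_eq_intros DERIV_chain2 [OF F])
    hence "(f has_integral (F (of_real R * \<epsilon>) / \<epsilon> - F (of_real 0 * \<epsilon>) / \<epsilon>)) {0..R}"
      unfolding f_def using R eps
      by (intro fundamental_theorem_of_calculus has_vector_derivative_real_field) auto
    hence "((\<lambda>y. if y \<in> {0..R} then f y else 0) has_integral ((F (of_real R * \<epsilon>) - F 0) / \<epsilon>)) {0..}"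
      by (subst has_integral_restrict) (auto simp: diff_divide_distrib)
    moreover have "(h has_integral (\<Sum>k<M. \<epsilon> ^ k * of_real (laplace_coeff k))) {0..}"
      unfolding h_def
      by (intro has_integral_sum has_integral_mult_right has_integral_of_real laplace_coeff_integral) auto
    ultimately have int: "((\<lambda>y. (if y \<in> {0..R} then f y else 0) - h y) has_integral
                       ((F (of_real R * \<epsilon>) - F 0) / \<epsilon> - (\<Sum>k<M. \<epsilon> ^ k * of_real (laplace_coeff k)))) {0..}"
      by (rule has_integral_diff)
    have "norm ((F (of_real R * \<epsilon>) - F 0) / \<epsilon> - (\<Sum>k<M. \<epsilon> ^ k * of_real (laplace_coeff k))) \<le>
            integral {0..} (\<lambda>y::real. norm \<epsilon> ^ M * (y ^ M * exp (- y\<^sup>2 / 4)))"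
      unfolding int [THEN integral_unique, symmetric]
    proof (rule integral_norm_bound_integral)
      fix y :: real assume "y \<in> {0..}"
      hence y: "y \<ge> 0" by simp
      define s where "s = of_real y * \<epsilon>"
      have h_eq: "h y = of_real (exp (- y\<^sup>2 / 2)) * (\<Sum>k<M. of_real (expc (- y\<^sup>2) k) * s ^ k)"
        unfolding h_def sum_distrib_left by (intro sum.cong) (auto simp: s_def power_mult_distrib)
      have s: "norm s = y * norm \<epsilon>"
        using y by (simp add: s_def norm_mult)
      \<comment> \<open>Up to \<open>R\<close> this is the remainder of the expansion, beyond
        \<open>R\<close> the truncated expansion alone; both have the same bound.\<close>
      have "norm ((if y \<in> {0..R} then f y else 0) - h y) \<le>
              exp (- y\<^sup>2 / 2) * (norm s ^ M * exp (y\<^sup>2 * (exp 1 - 5 / 2)))"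
      proof (cases "y \<le> R")
        case True
        hence "norm s \<le> 1" using eps unfolding s R_def by (simp add: field_simps)
        from norm_exp_exp_quot_remainder_le [OF _ this, of "y\<^sup>2" M] True y show ?thesis
          unfolding f_eq h_eq s_def [symmetric]
          by (auto simp: right_diff_distrib [symmetric] norm_mult simp del: of_real_exp of_real_power)
      next
        case False
        hence "norm s \<ge> 1" using eps unfolding s R_def by (simp add: field_simps)
        from norm_sum_expc_le [OF _ this, of "y\<^sup>2" M] False show ?thesis
          unfolding h_eq s_def [symmetric] by (auto simp: norm_mult simp del: of_real_exp of_real_power)
      qed
      also have "\<dots> = norm s ^ M * exp (- y\<^sup>2 / 2 + y\<^sup>2 * (exp 1 - 5 / 2))"
        by (simp only: exp_add mult_ac)
      \<comment> \<open>The total exponent is (e - 3) y^2, and e is at most 11/4.\<close>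
      also have "\<dots> \<le> norm s ^ M * exp (- y\<^sup>2 / 4)"
        using mult_left_mono [OF exp_1_le, of "y\<^sup>2"] by (intro mult_left_mono) (auto simp: algebra_simps)
      finally show "norm ((if y \<in> {0..R} then f y else 0) - h y) \<le> norm \<epsilon> ^ M * (y ^ M * exp (- y\<^sup>2 / 4))"
        by (simp add: s power_mult_distrib mult_ac)
    qed (use int integrable_on_mult_right [OF power_mult_gaussian_integrable] in \<open>auto simp: integrable_on_def\<close>)
    also have "\<dots> = norm \<epsilon> ^ M * C"
      unfolding C_def by simp
    finally have "norm \<epsilon> * norm ((F (of_real R * \<epsilon>) - F 0) / \<epsilon> - (\<Sum>k<M. \<epsilon> ^ k * of_real (laplace_coeff k))) \<le>
            norm \<epsilon> * (norm \<epsilon> ^ M * C)"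
      by (intro mult_left_mono) auto
    also have "norm \<epsilon> * norm ((F (of_real R * \<epsilon>) - F 0) / \<epsilon> - (\<Sum>k<M. \<epsilon> ^ k * of_real (laplace_coeff k))) =
      norm (F (of_real R * \<epsilon>) - F 0 - (\<Sum>k<M. of_real (laplace_coeff k) * \<epsilon> ^ (k + 1)))"
    proof -
      have "\<epsilon> * (D / \<epsilon> - (\<Sum>k<M. \<epsilon> ^ k * of_real (laplace_coeff k))) =
              D - (\<Sum>k<M. of_real (laplace_coeff k) * \<epsilon> ^ (k + 1))" for D
        using eps by (simp add: right_diff_distrib sum_distrib_left mult_ac)
      thus ?thesis
        unfolding norm_mult [symmetric] by simp
    qed
    finally show ?thesis
      by (simp add: R_def mult_ac)
  qed
  thus ?thesis by blast
qed

subsection \<open>Contour representation of the gamma functions\<close>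

text \<open>The strip contains both the horizontal ray from a and the positive real axis. Half of
  the decay of exp(-w) absorbs the growth of |w|^(Re a), and the argument of w contributes at most
  exp(pi |Im a|).\<close>

lemma powr_exp_bound:
  fixes a :: complex
  assumes a: "Re a > 0"
  obtains C where "C > 0"
    "\<And>w. Re w > 0 \<Longrightarrow> \<bar>Im w\<bar> \<le> \<bar>Im a\<bar> \<Longrightarrow> norm (w powr (a - 1) * exp (- w)) \<le> C * exp (- Re w / 2) / norm w"
proof
  define p where "p = Re a"
  define C where "C = exp (pi * \<bar>Im a\<bar> + p * ln (2 * p) - p + \<bar>Im a\<bar> / 2)"
  show "C > 0" by (simp add: C_def)
  fix w :: complex assume w: "Re w > 0" "\<bar>Im w\<bar> \<le> \<bar>Im a\<bar>"
  have p: "p > 0" using a by (simp add: p_def)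
  have nw: "norm w > 0" using w by auto
  have w0: "w \<noteq> 0" using w by auto
  have "norm w \<le> Re w + \<bar>Im a\<bar>"
    using cmod_le [of w] w by linarith
  \<comment> \<open>The scale 2p is chosen so that |w|^p costs no more than a constant times
    exp(|w|/2).\<close>
  have "ln (norm w / (2 * p)) \<le> norm w / (2 * p) - 1"
    using nw p by (intro ln_le_minus_one) auto
  hence "p * (ln (norm w) - ln (2 * p)) \<le> p * (norm w / (2 * p) - 1)"
    using p nw by (intro mult_left_mono) (auto simp: ln_div)
  hence 1: "p * ln (norm w) \<le> norm w / 2 + p * ln (2 * p) - p"
    using p by (simp add: algebra_simps)
  have 2: "- (Im a * Arg w) \<le> pi * \<bar>Im a\<bar>"
  proof -
    have "- (Im a * Arg w) \<le> \<bar>Im a\<bar> * \<bar>Arg w\<bar>"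
      by (metis abs_ge_minus_self abs_mult)
    also have "\<dots> \<le> \<bar>Im a\<bar> * pi"
      using Arg_bounded [of w] by (intro mult_left_mono) auto
    finally show ?thesis by (simp add: mult_ac)
  qed
  have "norm (w powr (a - 1)) = exp ((p - 1) * ln (norm w) - Im a * Arg w)"
    using w0 by (simp add: powr_def p_def Arg_eq_Im_Ln)
  hence "norm (w powr (a - 1) * exp (- w)) = exp (p * ln (norm w) - Im a * Arg w - Re w) / norm w"
    using nw by (simp only: norm_mult norm_exp_eq_Re) (simp add: left_diff_distrib exp_diff exp_minus exp_add field_simps)
  also have "\<dots> \<le> exp (norm w / 2 + p * ln (2 * p) - p + pi * \<bar>Im a\<bar> - Re w) / norm w"
    using 1 2 by (intro divide_right_mono) auto
  also have "\<dots> \<le> exp ((Re w + \<bar>Im a\<bar>) / 2 + p * ln (2 * p) - p + pi * \<bar>Im a\<bar> - Re w) / norm w"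
    using \<open>norm w \<le> Re w + \<bar>Im a\<bar>\<close> by (intro divide_right_mono) auto
  also have "exp ((Re w + \<bar>Im a\<bar>) / 2 + p * ln (2 * p) - p + pi * \<bar>Im a\<bar> - Re w) = C * exp (- Re w / 2)"
    unfolding C_def exp_add [symmetric] by (simp add: field_simps)
  finally show "norm (w powr (a - 1) * exp (- w)) \<le> C * exp (- Re w / 2) / norm w" .
qed

lemma upper_Gamma_integrable:
  assumes a: "Re a > 0"
  shows "set_integrable lborel {0..} (\<lambda>s. (a + of_real s) powr (a - 1) * exp (- (a + of_real s)))"
proof -
  define f where "f s = (a + of_real s) powr (a - 1) * exp (- (a + of_real s))" for s
  obtain C where C: "C > 0" "\<And>w. Re w > 0 \<Longrightarrow> \<bar>Im w\<bar> \<le> \<bar>Im a\<bar> \<Longrightarrow>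
     norm (w powr (a - 1) * exp (- w)) \<le> C * exp (- Re w / 2) / norm w"
    using powr_exp_bound [OF a] by blast
  have cont: "continuous_on {0..} f"
    unfolding f_def using a
    by (intro continuous_intros) (auto simp: complex_nonpos_Reals_iff complex_eq_iff)
  have meas: "(\<lambda>x. indicator {0..} x *\<^sub>R f x) \<in> borel_measurable borel"
    by (rule borel_measurable_continuous_on_indicator [OF _ cont]) auto
  have bound: "norm (f x) \<le> C * exp (- (1/2) * x) / norm a" if "x \<ge> 0" for x
  proof -
    have "norm a \<le> norm (a + of_real x)"
      using a that by (auto simp: cmod_def intro!: power_mono)
    moreover have "norm a > 0" using a by auto
    moreover have "norm (f x) \<le> C * exp (- Re (a + of_real x) / 2) / norm (a + of_real x)"
      unfolding f_def using a that by (intro C(2)) auto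
    moreover have "exp (- Re (a + of_real x) / 2) \<le> exp (- (1/2) * x)"
      using a by simp
    ultimately show ?thesis
      using C(1) by (smt (verit, ccfv_SIG) frac_le mult_left_mono exp_gt_zero mult_pos_pos)
  qed
  have "(\<lambda>x. C * exp (- (1/2) * x) / norm a) absolutely_integrable_on {0..}"
  proof (rule nonnegative_absolutely_integrable_1)
    have "((\<lambda>x::real. exp (- (1/2) * x)) has_integral exp (- (1/2) * 0) / (1/2)) {0..}"
      by (rule has_integral_exp_minus_to_infinity) auto
    thus "(\<lambda>x. C * exp (- (1/2) * x) / norm a) integrable_on {0..}"
      by (intro integrable_on_divide integrable_on_mult_right) (auto simp: integrable_on_def)
  qed (use C in auto)
  hence int: "integrable lebesgue (\<lambda>x. indicator {0..} x *\<^sub>R (C * exp (- (1/2) * x) / norm a))"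
    by (simp add: set_integrable_def)
  have "integrable lborel (\<lambda>x. indicator {0..} x *\<^sub>R (C * exp (- (1/2) * x) / norm a))"
    using int by (subst (asm) integrable_completion) auto
  hence "integrable lborel (\<lambda>x. indicator {0..} x *\<^sub>R f x)"
    by (rule Bochner_Integration.integrable_bound)
       (use meas bound C(1) in \<open>auto simp: indicator_def abs_mult intro!: AE_I2\<close>)
  thus ?thesis by (simp add: set_integrable_def f_def)
qed

text \<open>The substitution t = a exp s turns F into the primitive \<open>G\<close> of t^(a-1)
  exp(-t) on the right half-plane. The points t = n + 1 and t = 1/(n + 1) correspond to the
  arguments of F, which move to the two ends of the line Im s = -arg a.\<close>

lemma Gamma_primitive_limits:
  assumes a: "Re a > 0" and F: "\<And>s. (F has_field_derivative exp (- a * psi s)) (at s)"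
  defines "K \<equiv> a powr a * exp (- a)"
  shows "(\<lambda>n. F (of_real (ln (real (Suc n))) - Ln a)) \<longlonglongrightarrow> upper_Gamma a a / K + F 0"
    and "(\<lambda>n. F (- of_real (ln (real (Suc n))) - Ln a)) \<longlonglongrightarrow> upper_Gamma a a / K + F 0 - Gamma a / K"
proof -
  have a0: "a \<noteq> 0" using a by auto
  have K0: "K \<noteq> 0" using a0 by (simp add: K_def)
  define G where "G t = K * F (Ln t - Ln a)" for t
  have G: "(G has_field_derivative t powr (a - 1) * exp (- t)) (at t)" if t: "Re t > 0" for t
  proof -
    have t0: "t \<noteq> 0" and t': "t \<notin> \<real>\<^sub>\<le>\<^sub>0" using t by (auto simp: complex_nonpos_Reals_iff)
    have *: "- a * psi (Ln t - Ln a) = - t + a + a * Ln t - a * Ln a"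
      using a0 t0 by (simp add: psi_def exp_diff algebra_simps)
    have "K * (exp (- a * psi (Ln t - Ln a)) * inverse t) = t powr (a - 1) * exp (- t)"
      unfolding * using t0 a0
      by (simp add: K_def powr_def exp_add exp_diff exp_minus field_simps)
    thus ?thesis
      unfolding G_def using t' t0
      by (auto intro!: derivative_eq_intros DERIV_chain2 [OF F] simp: mult_ac)
  qed
  have "set_integrable lborel (\<Union>n. {0..real n}) (\<lambda>s. (a + of_real s) powr (a - 1) * exp (- (a + of_real s)))"
    by (rule set_integrable_subset [OF upper_Gamma_integrable [OF a]]) auto
  hence "(\<lambda>n. LBINT s:{0..real n}. (a + of_real s) powr (a - 1) * exp (- (a + of_real s))) \<longlonglongrightarrow>
     (LBINT s:(\<Union>n. {0..real n}). (a + of_real s) powr (a - 1) * exp (- (a + of_real s)))"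
    by (intro set_integral_cont_up) (auto simp: incseq_def)
  also have "(\<Union>n. {0..real n}) = {0..}"
    by (auto simp: real_arch_simple)
  also have "(LBINT s:{0..}. (a + of_real s) powr (a - 1) * exp (- (a + of_real s))) = upper_Gamma a a"
    by (simp add: upper_Gamma_def)
  also have "(\<lambda>n. LBINT s:{0..real n}. (a + of_real s) powr (a - 1) * exp (- (a + of_real s))) =
             (\<lambda>n. G (a + of_nat n) - G a)"
  proof
    fix n
    have "set_integrable lborel {0..real n} (\<lambda>s. (a + of_real s) powr (a - 1) * exp (- (a + of_real s)))"
      by (rule set_integrable_subset [OF upper_Gamma_integrable [OF a]]) auto
    hence "(LBINT s:{0..real n}. (a + of_real s) powr (a - 1) * exp (- (a + of_real s))) =
           integral {0..real n} (\<lambda>s. (a + of_real s) powr (a - 1) * exp (- (a + of_real s)))"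
      by (rule set_borel_integral_eq_integral)
    also have "((\<lambda>s. (a + of_real s) powr (a - 1) * exp (- (a + of_real s))) has_integral
                 (G (a + of_real (real n)) - G (a + of_real 0))) {0..real n}"
      using a by (intro fundamental_theorem_of_calculus has_vector_derivative_real_field DERIV_chain' [OF _ G, THEN DERIV_cong])
         (auto intro!: derivative_eq_intros)
    hence "integral {0..real n} (\<lambda>s. (a + of_real s) powr (a - 1) * exp (- (a + of_real s))) = G (a + of_nat n) - G a"
      by (simp add: integral_unique)
    finally show "(LBINT s:{0..real n}. (a + of_real s) powr (a - 1) * exp (- (a + of_real s))) = G (a + of_nat n) - G a" .
  qed
  finally have 1: "(\<lambda>n. G (a + of_nat n) - G a) \<longlonglongrightarrow> upper_Gamma a a" .
  \<comment> \<open>Moves the end of the path from the horizontal ray through a to the real axis: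
    the joining segment has length |a| and lies in a strip where the integrand is exponentially
    small.\<close>
  have 2: "(\<lambda>n. G (of_nat (Suc n)) - G (a + of_nat (Suc n))) \<longlonglongrightarrow> 0"
  proof -
    obtain C where C: "C > 0" "\<And>w. Re w > 0 \<Longrightarrow> \<bar>Im w\<bar> \<le> \<bar>Im a\<bar> \<Longrightarrow>
       norm (w powr (a - 1) * exp (- w)) \<le> C * exp (- Re w / 2) / norm w"
      using powr_exp_bound [OF a] by blast
    have "norm (G (of_nat (Suc n)) - G (a + of_nat (Suc n))) \<le> C * exp (- real (Suc n) / 2) * norm a" for n
    proof -
      define S where "S = {w. Re w \<ge> real (Suc n)} \<inter> {w. \<bar>Im w\<bar> \<le> \<bar>Im a\<bar>}"
      have "S = {w. Re w \<ge> real (Suc n)} \<inter> {w. Im w \<le> \<bar>Im a\<bar>} \<inter> {w. Im w \<ge> -\<bar>Im a\<bar>}"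
        by (auto simp: S_def)
      hence "convex S"
        by (auto intro!: convex_Int convex_halfspace_Re_ge convex_halfspace_Im_ge convex_halfspace_Im_le)
      have "norm (G (of_nat (Suc n)) - G (a + of_nat (Suc n))) \<le>
              C * exp (- real (Suc n) / 2) * norm (of_nat (Suc n) - (a + of_nat (Suc n)))"
      proof (rule field_differentiable_bound [OF \<open>convex S\<close>])
        fix w assume w: "w \<in> S"
        hence w': "Re w \<ge> 1 + real n" "\<bar>Im w\<bar> \<le> \<bar>Im a\<bar>"
          by (auto simp: S_def)
        show "(G has_field_derivative w powr (a - 1) * exp (- w)) (at w within S)"
          using w' by (intro has_field_derivative_at_within [OF G]) auto
        have "norm w \<ge> 1" using w' complex_Re_le_cmod [of w] by linarith
        have "norm (w powr (a - 1) * exp (- w)) \<le> C * exp (- Re w / 2) / norm w"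
          using w' by (intro C) auto
        also have "\<dots> \<le> C * exp (- Re w / 2) / 1"
          using \<open>norm w \<ge> 1\<close> C by (intro divide_left_mono) auto
        also have "\<dots> \<le> C * exp (- real (Suc n) / 2)"
          using C w' by auto
        finally show "norm (w powr (a - 1) * exp (- w)) \<le> C * exp (- real (Suc n) / 2)" .
      qed (use a in \<open>auto simp: S_def\<close>)
      thus ?thesis by simp
    qed
    moreover have "(\<lambda>n. C * exp (- real (Suc n) / 2) * norm a) \<longlonglongrightarrow> 0"
      by real_asymp
    ultimately show ?thesis
      by (rule Lim_null_comparison [OF always_eventually [OF allI]])
  qed
  have "(\<lambda>n. (G (a + of_nat (Suc n)) - G a) + (G (of_nat (Suc n)) - G (a + of_nat (Suc n))) + G a) \<longlonglongrightarrow>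
          upper_Gamma a a + 0 + G a"
    by (intro tendsto_intros 2 filterlim_compose [OF 1 filterlim_Suc, unfolded o_def])
  hence 3: "(\<lambda>n. G (of_nat (Suc n))) \<longlonglongrightarrow> upper_Gamma a a + G a"
    by simp
  \<comment> \<open>These intervals exhaust the positive axis, and both endpoints belong to the
    sequences in the claim.\<close>
  define A where "A n = {1 / real (Suc n)..real (Suc n)}" for n
  define g where "g t = of_real t powr (a - 1) / of_real (exp t)" for t :: real
  have UA: "(\<Union>n. A n) = {0<..}"
  proof (intro equalityI subsetI)
    fix x :: real assume "x \<in> {0<..}"
    hence x: "x > 0" by simp
    obtain n where "real n > max x (1 / x)" using reals_Archimedean2 by blast
    hence "real (Suc n) \<ge> x" "real (Suc n) \<ge> 1 / x" by auto
    hence "x \<in> A n" using x by (auto simp: A_def field_simps)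
    thus "x \<in> (\<Union>n. A n)" by blast
  qed (auto simp: A_def intro: less_le_trans [rotated])
  have g_int: "g absolutely_integrable_on {0<..}"
    unfolding g_def using absolutely_integrable_Gamma_integral' [OF a] .
  have "(\<lambda>n. LINT t:A n|lebesgue. g t) \<longlonglongrightarrow> (LINT t:(\<Union>n. A n)|lebesgue. g t)"
  proof (rule set_integral_cont_up)
    show "incseq A"
      by (auto simp: incseq_def A_def intro: order_trans [rotated] divide_left_mono)
    show "g absolutely_integrable_on (\<Union>n. A n)"
      unfolding UA by (fact g_int)
  qed (auto simp: A_def)
  also have "(LINT t:(\<Union>n. A n)|lebesgue. g t) = Gamma a"
    unfolding UA set_lebesgue_integral_eq_integral(2) [OF g_int]
    using Gamma_integral_complex' [OF a] unfolding g_def by (rule integral_unique)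
  also have "(\<lambda>n. LINT t:A n|lebesgue. g t) = (\<lambda>n. G (of_nat (Suc n)) - G (of_real (1 / real (Suc n))))"
  proof
    fix n
    have "g absolutely_integrable_on A n"
      by (rule set_integrable_subset [OF g_int]) (auto simp: A_def intro: less_le_trans [rotated])
    hence "(LINT t:A n|lebesgue. g t) = integral (A n) g"
      by (rule set_lebesgue_integral_eq_integral)
    also have "(g has_integral (G (of_real (real (Suc n))) - G (of_real (1 / real (Suc n))))) (A n)"
      unfolding A_def
    proof (intro fundamental_theorem_of_calculus has_vector_derivative_real_field)
      fix x assume "x \<in> {1 / real (Suc n)..real (Suc n)}"
      hence "x > 0" by (auto intro: less_le_trans [rotated])
      from G [of "of_real x"] this show "(G has_field_derivative g x) (at (of_real x))"
        by (simp add: g_def exp_minus exp_of_real [symmetric] field_simps)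
    qed (auto simp: field_simps)
    hence "integral (A n) g = G (of_nat (Suc n)) - G (of_real (1 / real (Suc n)))"
      by (simp add: integral_unique del: of_nat_Suc)
    finally show "(LINT t:A n|lebesgue. g t) = G (of_nat (Suc n)) - G (of_real (1 / real (Suc n)))" .
  qed
  finally have 4: "(\<lambda>n. G (of_nat (Suc n)) - G (of_real (1 / real (Suc n)))) \<longlonglongrightarrow> Gamma a" .
  have "(\<lambda>n. G (of_nat (Suc n)) / K) \<longlonglongrightarrow> (upper_Gamma a a + G a) / K"
    by (intro tendsto_intros 3 K0)
  also have "(\<lambda>n. G (of_nat (Suc n)) / K) = (\<lambda>n. F (of_real (ln (real (Suc n))) - Ln a))"
    using K0 by (simp add: G_def Ln_of_nat del: of_nat_Suc)
  finally show "(\<lambda>n. F (of_real (ln (real (Suc n))) - Ln a)) \<longlonglongrightarrow> upper_Gamma a a / K + F 0"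
    using K0 by (simp add: G_def add_divide_distrib del: of_nat_Suc)
  \<comment> \<open>The limit at the left end is the limit at the right end minus the complete
    integral.\<close>
  have "(\<lambda>n. (G (of_nat (Suc n)) - (G (of_nat (Suc n)) - G (of_real (1 / real (Suc n))))) / K) \<longlonglongrightarrow>
          (upper_Gamma a a + G a - Gamma a) / K"
    by (intro tendsto_diff tendsto_divide tendsto_const 3 4 K0)
  also have "(\<lambda>n. (G (of_nat (Suc n)) - (G (of_nat (Suc n)) - G (of_real (1 / real (Suc n))))) / K) =
               (\<lambda>n. F (- of_real (ln (real (Suc n))) - Ln a))"
  proof
    fix n
    have "Ln (of_real (1 / real (Suc n))) = of_real (ln (1 / real (Suc n)))"
      by (rule Ln_of_real) auto
    also have "ln (1 / real (Suc n)) = - ln (real (Suc n))"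
      by (simp add: ln_div)
    finally show "(G (of_nat (Suc n)) - (G (of_nat (Suc n)) - G (of_real (1 / real (Suc n))))) / K =
               F (- of_real (ln (real (Suc n))) - Ln a)"
      using K0 by (simp add: G_def)
  qed
  finally show "(\<lambda>n. F (- of_real (ln (real (Suc n))) - Ln a)) \<longlonglongrightarrow> upper_Gamma a a / K + F 0 - Gamma a / K"
    using K0 by (simp add: G_def add_divide_distrib diff_divide_distrib del: of_nat_Suc)
qed

subsection \<open>The tails of the contour\<close>

text \<open>With t = arg a, multiplication by |a| gives the exponent of decay of exp(-a
  psi(s)).\<close>

lemma Re_cis_psi:
  "Re (cis t * psi (Complex x y)) = exp x * cos (t + y) - cos t * (1 + x) + sin t * y"
  by (simp add: psi_def cos_add algebra_simps Re_exp Im_exp)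

text \<open>Here b is half the argument of a. The bound b/2 on the sine holds because the cosine is
  at least 1/2 up to pi/3.\<close>

lemma cis_in_first_octant:
  assumes "0 \<le> b" "b < pi / 4"
  shows "cos b \<ge> 7 / 10" "0 \<le> sin b" "sin b \<le> b" "b / 2 \<le> sin b" "cos (2 * b) > 0"
proof -
  have "sqrt 2 / 2 \<le> cos b"
    using cos_monotone_0_pi_le [of b "pi / 4"] assms by (simp add: cos_45)
  moreover have "7 / 5 \<le> sqrt 2"
    by (rule real_le_rsqrt) (simp add: power2_eq_square)
  ultimately show "cos b \<ge> 7 / 10" by simp
  show "0 \<le> sin b" "sin b \<le> b"
    using assms by (auto intro: sin_ge_zero sin_x_le_x)
  have "sin 0 - 0 / 2 \<le> sin b - b / 2"
  proof (rule DERIV_nonneg_imp_nondecreasing [OF assms(1)])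
    fix x assume x: "0 \<le> x" "x \<le> b"
    have "cos (pi / 3) \<le> cos x"
      using x assms by (intro cos_monotone_0_pi_le) auto
    hence "((\<lambda>x. sin x - x / 2) has_real_derivative cos x - 1 / 2) (at x) \<and> cos x - 1 / 2 \<ge> 0"
      by (auto intro!: derivative_eq_intros simp: cos_60)
    thus "\<exists>y. ((\<lambda>x. sin x - x / 2) has_real_derivative y) (at x) \<and> y \<ge> 0" by blast
  qed
  thus "b / 2 \<le> sin b" by simp
  show "cos (2 * b) > 0"
    using assms by (intro cos_gt_zero_pi) auto
qed

lemma Ln_of_real_mult_cis:
  assumes "r > 0" "- pi < t" "t \<le> pi"
  shows "Ln (of_real r * cis t) = Complex (ln r) t"
proof -
  have "of_real r * cis t = exp (Complex (ln r) t)"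
    using assms by (simp add: exp_eq_polar exp_of_real [symmetric])
  thus ?thesis using assms by simp
qed

lemma Complex_has_vector_derivative:
  "((\<lambda>x. Complex x y) has_vector_derivative 1) (at x)"
proof -
  have "((\<lambda>x. of_real x + \<i> * of_real y) has_vector_derivative 1) (at x)"
    by (auto intro!: derivative_eq_intros)
  thus ?thesis by (simp add: Complex_eq)
qed

text \<open>
  Path: horizontally from \<open>cis (-b)\<close> to real part \<open>P\<close>, then vertically down to imaginary part \<open>-2b\<close>.
\<close>
lemma tail_right:
  fixes F :: "complex \<Rightarrow> complex"
  assumes b: "0 \<le> b" "b < pi / 4" and r: "r \<ge> 1"
  assumes F: "\<And>s. (F has_field_derivative exp (- (of_real r * cis (2 * b)) * psi s)) (at s)"
  assumes lim: "(\<lambda>n. F (of_real (ln (real (Suc n))) - Ln (of_real r * cis (2 * b)))) \<longlonglongrightarrow> L"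
  assumes start: "Re (cis (2 * b) * psi (cis (-b))) \<ge> 1 / 4"
  shows "norm (L - F (cis (-b))) \<le> 2 / cos (3 * pi / 8) * exp (- r / 4)"
proof -
  define q where "q = sin b"
  define p where "p = cos b"
  define k where "k = cos (3 * pi / 8)"
  note o = cis_in_first_octant [OF b]
  have k: "k > 0" unfolding k_def by (intro cos_gt_zero) auto
  have q: "0 \<le> q" "q \<le> b" "b / 2 \<le> q" and p: "p \<ge> 7 / 10"
    using o by (auto simp: q_def p_def)
  have cis: "cis (-b) = Complex p (-q)"
    by (simp add: p_def q_def complex_eq_iff)
  have nF: "norm (exp (- (of_real r * cis (2 * b)) * psi s)) = exp (- (r * Re (cis (2 * b) * psi s)))" for s
    by (simp add: norm_exp_eq_Re mult.assoc)
  \<comment> \<open>Since q is at least b/2, the angle 2b - y is at most 3b/2 < 3 pi/8. This keeps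
    the cosine away from 0 uniformly as 2b approaches pi/2.\<close>
  have cosk: "k \<le> cos (2 * b - y)" "cos (2 * b) \<le> cos (2 * b - y)" if "q \<le> y" "y \<le> 2 * b" for y
    unfolding k_def using that q b by (intro cos_monotone_0_pi_le; simp)+
  have horizontal: "norm (F (Complex P (-q)) - F (Complex p (-q))) \<le> 2 / k * exp (- r / 4)" if P: "P > p" for P
  proof -
    define k1 where "k1 = k / 2"
    have k1: "k1 > 0" using k by (simp add: k1_def)
    \<comment> \<open>A real primitive of the bound on the integrand, for a decay exponent that
      starts at 1/4 and grows at least at rate \<open>k1\<close>.\<close>
    define \<phi> where "\<phi> x = - exp (- (r / 4 + r * k1 * (x - p))) / (r * k1)" for x
    have "norm (F (Complex P (-q)) - F (Complex p (-q))) \<le> \<phi> P - \<phi> p"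
    proof (rule differentiable_bound_general [OF P])
      have D: "((\<lambda>x. F (Complex x (-q))) has_vector_derivative
                exp (- (of_real r * cis (2 * b)) * psi (Complex x (-q)))) (at x)" for x
        using field_vector_diff_chain_at [OF Complex_has_vector_derivative F] by (simp add: o_def)
      show "((\<lambda>x. F (Complex x (-q))) has_vector_derivative
                exp (- (of_real r * cis (2 * b)) * psi (Complex x (-q)))) (at x)" for x
        by (rule D)
      show "continuous_on {p..P} (\<lambda>x. F (Complex x (-q)))"
        using D by (intro continuous_at_imp_continuous_on) (auto intro: has_vector_derivative_continuous)
      have D2: "(\<phi> has_vector_derivative exp (- (r / 4 + r * k1 * (x - p)))) (at x)" for x
        unfolding \<phi>_def has_real_derivative_iff_has_vector_derivative [symmetric] using r k1
        by (auto intro!: derivative_eq_intros)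
      show "(\<phi> has_vector_derivative exp (- (r / 4 + r * k1 * (x - p)))) (at x)" for x by (rule D2)
      show "continuous_on {p..P} \<phi>"
        using D2 by (intro continuous_at_imp_continuous_on) (auto intro: has_vector_derivative_continuous)
      fix x assume x: "p < x" "x < P"
      \<comment> \<open>The tangent of exp at p has slope at least 3/2, so after subtracting x - p a
        growth of (x - p)/2 remains.\<close>
      define d where "d = exp p * (x - p)"
      have "exp p * (1 + (x - p)) \<le> exp x"
        using exp_ge_add_one_self [of "x - p"] mult_left_mono [of "1 + (x - p)" "exp (x - p)" "exp p"]
        by (simp flip: exp_add)
      hence "exp p + d \<le> exp x" by (simp add: d_def algebra_simps)
      moreover have "exp p \<ge> 3 / 2" using exp_ge_add_one_self [of p] p by linarith
      hence "d \<ge> (3 / 2) * (x - p)"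
        unfolding d_def using x by (intro mult_right_mono) auto
      ultimately have "exp x - exp p - (x - p) \<ge> (x - p) / 2"
        by (simp add: field_simps)
      hence "(x - p) * k1 \<le> (exp x - exp p - (x - p)) * k"
        using k mult_right_mono [of "(x - p) / 2" "exp x - exp p - (x - p)" k] by (simp add: k1_def)
      also have "\<dots> \<le> (exp x - exp p - (x - p)) * cos (2 * b - q)"
        using cosk [of q] q \<open>exp x - exp p - (x - p) \<ge> (x - p) / 2\<close> x b by (intro mult_left_mono) auto
      also have "\<dots> \<le> (exp x - exp p) * cos (2 * b - q) - (x - p) * cos (2 * b)"
        using mult_left_mono [OF cosk(2) [of q], of "x - p"] x q b by (simp add: algebra_simps)
      \<comment> \<open>The imaginary part is constant on the path, so the sine terms
        cancel.\<close>
      also have "\<dots> = Re (cis (2 * b) * psi (Complex x (-q))) - Re (cis (2 * b) * psi (Complex p (-q)))"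
        unfolding Re_cis_psi by (simp add: algebra_simps)
      finally have "Re (cis (2 * b) * psi (Complex x (-q))) \<ge> 1 / 4 + k1 * (x - p)"
        using start unfolding cis by (simp add: mult_ac)
      from mult_left_mono [OF this, of r] r
      show "norm (exp (- (of_real r * cis (2 * b)) * psi (Complex x (-q)))) \<le> exp (- (r / 4 + r * k1 * (x - p)))"
        unfolding nF by (simp add: algebra_simps)
    qed
    also have "\<dots> \<le> exp (- r / 4) / (r * k1)"
      using r k1 by (simp add: \<phi>_def)
    also have "\<dots> \<le> exp (- r / 4) / (1 * k1)"
      using r k1 by (intro divide_left_mono mult_right_mono) auto
    finally show ?thesis by (simp add: k1_def mult_ac)
  qed
  \<comment> \<open>The term k exp P makes this piece vanish as P grows. The 3 is 1 from the
    constant term of psi plus the bound 2 on the imaginary part.\<close>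
  have vertical: "norm (F (Complex P (- (2 * b))) - F (Complex P (-q))) \<le> exp (r * (3 + P - k * exp P)) * 2" if P: "P > 0" for P
  proof -
    define S where "S = closed_segment (Complex P (-q)) (Complex P (- (2 * b)))"
    have "norm (F (Complex P (- (2 * b))) - F (Complex P (-q))) \<le>
          exp (r * (3 + P - k * exp P)) * norm (Complex P (- (2 * b)) - Complex P (-q))"
    proof (rule field_differentiable_bound [of S])
      fix z assume "z \<in> S"
      then obtain u where u: "0 \<le> u" "u \<le> 1" "z = (1 - u) *\<^sub>R Complex P (-q) + u *\<^sub>R Complex P (- (2 * b))"
        unfolding S_def in_segment by blast
      define y where "y = (1 - u) * q + u * (2 * b)"
      have z: "z = Complex P (- y)"
        unfolding u by (simp add: complex_eq_iff y_def algebra_simps)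
      have y: "q \<le> y" "y \<le> 2 * b"
        using u q b convex_bound_le [of "q" "2 * b" "2 * b" "1 - u" u] convex_bound_le [of "-q" "-q" "-(2 * b)" "1 - u" u]
        by (auto simp: y_def)
      show "(F has_field_derivative exp (- (of_real r * cis (2 * b)) * psi z)) (at z within S)"
        by (rule has_field_derivative_at_within [OF F])
      define t1 where "t1 = cos (2 * b) * (1 + P)"
      define t2 where "t2 = sin (2 * b) * y"
      define t3 where "t3 = cos (2 * b - y) * exp P"
      define t4 where "t4 = k * exp P"
      have "t1 \<le> 1 * (1 + P)"
        unfolding t1_def using P by (intro mult_right_mono) auto
      moreover have "t2 \<le> 1 * y"
        unfolding t2_def using y q by (intro mult_right_mono) auto
      moreover have "y \<le> 2" using y b pi_less_4 by simp
      moreover have "t4 \<le> t3"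
        unfolding t3_def t4_def using cosk y by (intro mult_right_mono) auto
      moreover have "Re (cis (2 * b) * psi z) = t3 - t1 - t2"
        unfolding z Re_cis_psi by (simp add: t1_def t2_def t3_def mult.commute)
      ultimately have "Re (cis (2 * b) * psi z) \<ge> - (3 + P - t4)"
        by simp
      hence "Re (cis (2 * b) * psi z) \<ge> - (3 + P - k * exp P)"
        by (simp add: t4_def)
      from mult_left_mono [OF this, of r] r
      show "norm (exp (- (of_real r * cis (2 * b)) * psi z)) \<le> exp (r * (3 + P - k * exp P))"
        unfolding nF by (simp add: algebra_simps)
    qed (auto simp: S_def)
    also have "norm (Complex P (- (2 * b)) - Complex P (-q)) \<le> 2"
      using q b pi_less_4 by (simp add: complex_diff cmod_def)
    finally show ?thesis by simp
  qed
  have Ln: "Ln (of_real r * cis (2 * b)) = Complex (ln r) (2 * b)"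
    using r b by (intro Ln_of_real_mult_cis) auto
  define P where "P n = ln (real (Suc n)) - ln r" for n
  have P: "filterlim P at_top sequentially"
    unfolding P_def by real_asymp
  have ev: "eventually (\<lambda>n. P n > p) sequentially"
    using P by (simp add: filterlim_at_top_dense)
  have bound: "eventually (\<lambda>n. norm (F (of_real (ln (real (Suc n))) - Ln (of_real r * cis (2 * b))) - F (cis (-b))) \<le>
                   2 / k * exp (- r / 4) + exp (r * (3 + P n - k * exp (P n))) * 2) sequentially"
    using ev
  proof eventually_elim
    case (elim n)
    have "of_real (ln (real (Suc n))) - Ln (of_real r * cis (2 * b)) = Complex (P n) (- (2 * b))"
      unfolding Ln P_def by (simp add: complex_eq_iff)
    thus ?case
      using norm_diff_triangle_le [OF vertical [of "P n"] horizontal [OF elim]] elim p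
      by (simp add: cis add.commute)
  qed
  have "((\<lambda>x. exp (r * (3 + x - k * exp x)) * 2) \<longlongrightarrow> 0) at_top"
    using r k by real_asymp
  hence "(\<lambda>n. exp (r * (3 + P n - k * exp (P n))) * 2) \<longlonglongrightarrow> 0"
    using P by (rule filterlim_compose)
  hence "(\<lambda>n. 2 / k * exp (- r / 4) + exp (r * (3 + P n - k * exp (P n))) * 2) \<longlonglongrightarrow> 2 / k * exp (- r / 4) + 0"
    by (intro tendsto_intros)
  moreover have "(\<lambda>n. norm (F (of_real (ln (real (Suc n))) - Ln (of_real r * cis (2 * b))) - F (cis (-b)))) \<longlonglongrightarrow>
                   norm (L - F (cis (-b)))"
    by (intro tendsto_intros lim)
  ultimately show ?thesis
    using bound unfolding k_def by (intro tendsto_le [OF sequentially_bot]) auto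
qed

text \<open>
  Path: along the ray through \<open>- cis (-b)\<close> to real part \<open>-P\<close>, then vertically down to imaginary part
  \<open>-2b\<close>. On a horizontal path the integrand decays only like \<open>exp (- r P cos (2b))\<close>, which is not
  uniform as \<open>2b\<close> approaches \<open>\<pi>/2\<close>.
\<close>
lemma tail_left:
  fixes F :: "complex \<Rightarrow> complex"
  assumes b: "0 \<le> b" "b < pi / 4" and r: "r \<ge> 1"
  assumes F: "\<And>s. (F has_field_derivative exp (- (of_real r * cis (2 * b)) * psi s)) (at s)"
  assumes lim: "(\<lambda>n. F (- of_real (ln (real (Suc n))) - Ln (of_real r * cis (2 * b)))) \<longlonglongrightarrow> L"
  assumes start: "Re (cis (2 * b) * psi (- cis (-b))) \<ge> 1 / 4"
  shows "norm (L - F (- cis (-b))) \<le> 12 * exp (- r / 12)"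
proof -
  define c where "c = cos b"
  define s where "s = sin b"
  note o = cis_in_first_octant [OF b]
  have s: "0 \<le> s" "s \<le> b" and c: "c \<ge> 7 / 10" "c \<le> 1"
    using o by (auto simp: s_def c_def)
  have cis: "of_real x * cis (-b) = Complex (x * c) (- (x * s))" for x
    by (simp add: c_def s_def complex_eq_iff)
  have nF: "norm (exp (- (of_real r * cis (2 * b)) * psi s)) = exp (- (r * Re (cis (2 * b) * psi s)))" for s
    by (simp add: norm_exp_eq_Re mult.assoc)
  \<comment> \<open>The decay exponent along the ray, divided by r. Its linear part is x cos b,
    because cos(2b) cos b + sin(2b) sin b = cos b, and cos b stays above 7/10.\<close>
  define e where "e x = Re (cis (2 * b) * psi (- (of_real x * cis (-b))))" for x
  have e: "e x = exp (- (x * c)) * cos (2 * b + x * s) - cos (2 * b) + x * c" for x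
  proof -
    have "e x = exp (- (x * c)) * cos (2 * b + x * s) - cos (2 * b) + x * (cos (2 * b) * c + sin (2 * b) * s)"
      unfolding e_def cis using Re_cis_psi [of "2 * b" "- (x * c)" "x * s"]
      by (simp add: algebra_simps complex_minus)
    also have "cos (2 * b) * c + sin (2 * b) * s = c"
      unfolding c_def s_def using cos_diff [of "2 * b" b] by simp
    finally show ?thesis .
  qed
  \<comment> \<open>Up to x = 3 monotonicity and e(1) at least 1/4 suffice, which fixes the rate
    1/12; beyond 3 the linear part dominates.\<close>
  have e_ge: "e x \<ge> x / 12" if x: "x \<ge> 1" for x
  proof (cases "x \<le> 3")
    case True
    have "e 1 \<le> e x"
    proof (rule DERIV_nonneg_imp_nondecreasing [OF x])
      fix t assume t: "1 \<le> t" "t \<le> x"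
      have D: "(e has_real_derivative c - exp (- (t * c)) * (c * cos (2 * b + t * s) + s * sin (2 * b + t * s))) (at t)"
        unfolding e by (auto intro!: derivative_eq_intros simp: algebra_simps)
      have "c * cos (2 * b + t * s) + s * sin (2 * b + t * s) = cos (b + t * s)"
        unfolding c_def s_def using cos_diff [of "2 * b + t * sin b" b] by (simp add: algebra_simps)
      also have "\<dots> \<le> c"
        unfolding c_def
      proof (rule cos_monotone_0_pi_le)
        \<comment> \<open>With t at most 3 the angle b + t s is at most 4b < pi, within the range
          where the cosine decreases.\<close>
        have "t * s \<le> 3 * b" using t True s by (intro mult_mono) auto
        thus "b + t * s \<le> pi" using b by simp
      qed (use t s b in auto)
      finally have "exp (- (t * c)) * (c * cos (2 * b + t * s) + s * sin (2 * b + t * s)) \<le> exp (- (t * c)) * c"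
        by (intro mult_left_mono) auto
      also have "\<dots> \<le> 1 * c" using t c by (intro mult_right_mono) auto
      finally show "\<exists>y. (e has_real_derivative y) (at t) \<and> y \<ge> 0"
        using D by (intro exI conjI) auto
    qed
    moreover have "e 1 \<ge> 1 / 4" using start by (simp add: e_def)
    ultimately show ?thesis using True by simp
  next
    case False
    have "x * c \<ge> x * (7 / 10)" using c x by (intro mult_left_mono) auto
    define u where "u = exp (- (x * c)) * cos (2 * b + x * s)"
    have "u \<ge> exp (- (x * c)) * (-1)"
      unfolding u_def by (intro mult_left_mono) auto
    moreover have "exp (- (x * c)) \<le> 1 / (1 + x * c)"
      using exp_ge_add_one_self [of "x * c"] x c by (simp add: exp_minus field_simps add_pos_nonneg)
    moreover have "x * c \<ge> 21 / 10"
      using \<open>x * c \<ge> x * (7 / 10)\<close> False by linarith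
    hence "1 / (1 + x * c) \<le> 1 / (1 + 21 / 10)"
      by (intro divide_left_mono mult_pos_pos) auto
    hence "1 / (1 + x * c) \<le> 10 / 31"
      by simp
    ultimately have "u \<ge> - (10 / 31)" by linarith
    hence "e x \<ge> - (10 / 31) - 1 + x * (7 / 10)"
      unfolding e u_def [symmetric] using \<open>x * c \<ge> x * (7 / 10)\<close> cos_le_one [of "2 * b"] by linarith
    thus ?thesis using False by simp
  qed
  have ray: "norm (F (- (of_real X * cis (-b))) - F (- cis (-b))) \<le> 12 * exp (- r / 12)" if X: "X > 1" for X
  proof -
    \<comment> \<open>A primitive of exp(-r x/12), the bound on the integrand given by
      \<open>e_ge\<close>.\<close>
    define \<phi> where "\<phi> x = - 12 * exp (- (r * x / 12)) / r" for x
    have "norm (F (- (of_real X * cis (-b))) - F (- (of_real 1 * cis (-b)))) \<le> \<phi> X - \<phi> 1"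
    proof (rule differentiable_bound_general [OF X])
      have D: "((\<lambda>x. F (- (of_real x * cis (-b)))) has_vector_derivative
                - cis (-b) * exp (- (of_real r * cis (2 * b)) * psi (- (of_real x * cis (-b))))) (at x)" for x
      proof -
        have "((\<lambda>x. - (of_real x * cis (-b))) has_vector_derivative - cis (-b)) (at x)"
          by (auto intro!: derivative_eq_intros)
        from field_vector_diff_chain_at [OF this F] show ?thesis by (simp add: o_def)
      qed
      show "((\<lambda>x. F (- (of_real x * cis (-b)))) has_vector_derivative
                - cis (-b) * exp (- (of_real r * cis (2 * b)) * psi (- (of_real x * cis (-b))))) (at x)" for x
        by (rule D)
      show "continuous_on {1..X} (\<lambda>x. F (- (of_real x * cis (-b))))"
        using D by (intro continuous_at_imp_continuous_on) (auto intro: has_vector_derivative_continuous)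
      have D2: "(\<phi> has_vector_derivative exp (- (r * x / 12))) (at x)" for x
        unfolding \<phi>_def has_real_derivative_iff_has_vector_derivative [symmetric] using r
        by (auto intro!: derivative_eq_intros)
      show "(\<phi> has_vector_derivative exp (- (r * x / 12))) (at x)" for x by (rule D2)
      show "continuous_on {1..X} \<phi>"
        using D2 by (intro continuous_at_imp_continuous_on) (auto intro: has_vector_derivative_continuous)
      fix x assume x: "1 < x" "x < X"
      have "r * (x / 12) \<le> r * e x"
        using e_ge [of x] x r by (intro mult_left_mono) auto
      thus "norm (- cis (-b) * exp (- (of_real r * cis (2 * b)) * psi (- (of_real x * cis (-b))))) \<le> exp (- (r * x / 12))"
        unfolding norm_mult nF e_def [symmetric] by simp
    qed
    also have "\<dots> \<le> 12 * exp (- r / 12) / r"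
      using r by (simp add: \<phi>_def)
    also have "\<dots> \<le> 12 * exp (- r / 12) / 1"
      using r by (intro divide_left_mono) auto
    finally show ?thesis by simp
  qed
  \<comment> \<open>The decay rate cos(2b) may be arbitrarily small, but this piece is used only
    through its limit for fixed b as P grows. The parameter P / c puts the point of the ray at real
    part -P.\<close>
  have vertical: "norm (F (Complex (-P) (- (2 * b))) - F (- (of_real (P / c) * cis (-b)))) \<le>
               exp (r * (4 - P * cos (2 * b))) * (2 * P + 2)" if P: "P > 1" for P
  proof -
    define Y where "Y = P / c * s"
    have "s / c \<le> 2"
      using c by (simp add: s_def field_simps) (use sin_le_one [of b] in linarith)
    hence Y: "Y \<ge> 0" "Y \<le> 2 * P"
      using mult_left_mono [of "s / c" 2 P] P c s by (auto simp: Y_def)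
    have eq: "- (of_real (P / c) * cis (-b)) = Complex (-P) Y"
      unfolding cis Y_def using c by (simp add: complex_eq_iff)
    define S where "S = closed_segment (Complex (-P) Y) (Complex (-P) (- (2 * b)))"
    have "norm (F (Complex (-P) (- (2 * b))) - F (Complex (-P) Y)) \<le>
          exp (r * (4 - P * cos (2 * b))) * norm (Complex (-P) (- (2 * b)) - Complex (-P) Y)"
    proof (rule field_differentiable_bound [of S])
      fix z assume "z \<in> S"
      then obtain u where u: "0 \<le> u" "u \<le> 1" "z = (1 - u) *\<^sub>R Complex (-P) Y + u *\<^sub>R Complex (-P) (- (2 * b))"
        unfolding S_def in_segment by blast
      define y where "y = (1 - u) * Y - u * (2 * b)"
      have z: "z = Complex (-P) y"
        unfolding u by (simp add: complex_eq_iff y_def algebra_simps)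
      have "u * (2 * b) \<le> 1 * 2" using u b pi_less_4 by (intro mult_mono) auto
      moreover have "(1 - u) * Y \<ge> 0" using u Y by simp
      ultimately have y: "y \<ge> -2" by (simp add: y_def)
      show "(F has_field_derivative exp (- (of_real r * cis (2 * b)) * psi z)) (at z within S)"
        by (rule has_field_derivative_at_within [OF F])
      have "sin (2 * b) * y \<ge> -2"
      proof (cases "y \<ge> 0")
        case True
        hence "sin (2 * b) * y \<ge> 0"
          using b by (intro mult_nonneg_nonneg sin_ge_zero) auto
        thus ?thesis by linarith
      next
        case False
        have "sin (2 * b) * (-y) \<le> 1 * 2" using False y by (intro mult_mono) auto
        thus ?thesis by simp
      qed
      moreover have "exp (-P) * cos (2 * b + y) \<ge> - 1"
      proof -
        have "exp (-P) * cos (2 * b + y) \<ge> exp (-P) * (- 1)"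
          by (intro mult_left_mono) auto
        thus ?thesis using P by (smt (verit) exp_le_one_iff)
      qed
      moreover have "Re (cis (2 * b) * psi z) =
          exp (-P) * cos (2 * b + y) - cos (2 * b) + P * cos (2 * b) + sin (2 * b) * y"
        unfolding z Re_cis_psi by (simp add: algebra_simps)
      ultimately have "Re (cis (2 * b) * psi z) \<ge> - (4 - P * cos (2 * b))"
        using cos_le_one [of "2 * b"] by linarith
      from mult_left_mono [OF this, of r] r
      show "norm (exp (- (of_real r * cis (2 * b)) * psi z)) \<le> exp (r * (4 - P * cos (2 * b)))"
        unfolding nF by (simp add: algebra_simps)
    qed (auto simp: S_def)
    also have "norm (Complex (-P) (- (2 * b)) - Complex (-P) Y) \<le> 2 * P + 2"
      using Y b pi_less_4 by (simp add: complex_diff cmod_def)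
    finally show ?thesis unfolding eq by simp
  qed
  have Ln: "Ln (of_real r * cis (2 * b)) = Complex (ln r) (2 * b)"
    using r b by (intro Ln_of_real_mult_cis) auto
  define P where "P n = ln (real (Suc n)) + ln r" for n
  have P: "filterlim P at_top sequentially"
    unfolding P_def by real_asymp
  have ev: "eventually (\<lambda>n. P n > 1) sequentially"
    using P by (simp add: filterlim_at_top_dense)
  have bound: "eventually (\<lambda>n. norm (F (- of_real (ln (real (Suc n))) - Ln (of_real r * cis (2 * b))) - F (- cis (-b))) \<le>
                   12 * exp (- r / 12) + exp (r * (4 - P n * cos (2 * b))) * (2 * P n + 2)) sequentially"
    using ev
  proof eventually_elim
    case (elim n)
    have "- of_real (ln (real (Suc n))) - Ln (of_real r * cis (2 * b)) = Complex (- P n) (- (2 * b))"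
      unfolding Ln P_def by (simp add: complex_eq_iff)
    moreover have "P n / c > 1" using elim c by (simp add: field_simps)
    ultimately show ?case
      using norm_diff_triangle_le [OF vertical [OF elim] ray [of "P n / c"]] by (simp add: add.commute)
  qed
  have "((\<lambda>x. exp (r * (4 - x * cos (2 * b))) * (2 * x + 2)) \<longlongrightarrow> 0) at_top"
    using r o(5) by real_asymp
  hence "(\<lambda>n. exp (r * (4 - P n * cos (2 * b))) * (2 * P n + 2)) \<longlonglongrightarrow> 0"
    using P by (rule filterlim_compose)
  hence "(\<lambda>n. 12 * exp (- r / 12) + exp (r * (4 - P n * cos (2 * b))) * (2 * P n + 2)) \<longlonglongrightarrow> 12 * exp (- r / 12) + 0"
    by (intro tendsto_intros)
  moreover have "(\<lambda>n. norm (F (- of_real (ln (real (Suc n))) - Ln (of_real r * cis (2 * b))) - F (- cis (-b)))) \<longlonglongrightarrow>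
                   norm (L - F (- cis (-b)))"
    by (intro tendsto_intros lim)
  ultimately show ?thesis
    using bound by (intro tendsto_le [OF sequentially_bot]) auto
qed

text \<open>The series has nonnegative coefficients, so on the closed unit disc the modulus is at
  most the value e - 5/2 at 1.\<close>

lemma norm_exp_quot_le:
  assumes "norm s \<le> 1"
  shows "norm (exp_quot s) \<le> 1 / 4"
proof -
  have "exp_quot 1 = of_real (exp 1 - 5 / 2)"
    using exp_quot [of 1] by (simp add: field_simps exp_of_real [symmetric])
  moreover have sums: "(\<lambda>n. exp_tail3_quot $ n * z ^ n) sums exp_quot z" for z
    unfolding exp_quot_def by (rule sums_eval_fps) simp
  ultimately have "(\<lambda>n. Re (exp_tail3_quot $ n * 1 ^ n)) sums (exp 1 - 5 / 2)"
    using sums_Re [OF sums [of 1]] by simp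
  moreover have "Re (exp_tail3_quot $ n * 1 ^ n) = norm (exp_tail3_quot $ n :: complex)" for n
  proof -
    have "exp_tail3_quot $ n = (of_real (exp_tail3_quot $ n) :: complex)"
      by (simp add: exp_tail3_quot_def)
    moreover have "exp_tail3_quot $ n \<ge> (0 :: real)"
      by (simp add: exp_tail3_quot_def)
    ultimately show ?thesis
      by (metis Re_complex_of_real abs_of_nonneg mult_1_right norm_of_real power_one)
  qed
  ultimately have "(\<lambda>n. norm (exp_tail3_quot $ n :: complex)) sums (exp 1 - 5 / 2)"
    by simp
  moreover have "norm (exp_tail3_quot $ n * s ^ n) \<le> norm (exp_tail3_quot $ n :: complex)" for n
    using assms by (auto simp: norm_mult norm_power intro!: mult_left_le power_le_one)
  ultimately have "norm (exp_quot s) \<le> exp 1 - 5 / 2"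
    using norm_suminf_le [of "\<lambda>n. exp_tail3_quot $ n * s ^ n" "\<lambda>n. norm (exp_tail3_quot $ n :: complex)"] sums [of s]
    by (simp add: sums_iff)
  thus ?thesis using exp_1_le by simp
qed

text \<open>The quotient is 1/2 + \<open>exp_quot\<close> w. This supplies the hypothesis
  \<open>start\<close> of the tail estimates: for w = cis(-b) or its negative, 1/w^2 is
  cis(2b).\<close>

lemma Re_psi_unit_ge:
  assumes "norm w = 1"
  shows "Re (psi w / w\<^sup>2) \<ge> 1 / 4"
proof -
  have "psi w = w\<^sup>2 / 2 + w\<^sup>2 * exp_quot w"
    unfolding exp_quot psi_def by simp
  moreover have "w \<noteq> 0" using assms by auto
  ultimately have "psi w / w\<^sup>2 = 1 / 2 + exp_quot w"
    by (simp add: field_simps)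
  moreover have "\<bar>Re (exp_quot w)\<bar> \<le> 1 / 4"
    using abs_Re_le_cmod [of "exp_quot w"] norm_exp_quot_le [of w] assms by linarith
  ultimately show ?thesis by simp
qed

text \<open>For Im a at least 0 this combines the two tail estimates; the case Im a < 0 follows by
  complex conjugation.\<close>

lemma contour_tail_bounds:
  "\<exists>C>0. \<forall>a F L L'. Re a > 0 \<longrightarrow> norm a \<ge> 1 \<longrightarrow>
       (\<forall>s. (F has_field_derivative exp (- a * psi s)) (at s)) \<longrightarrow>
       (\<lambda>n. F (of_real (ln (real (Suc n))) - Ln a)) \<longlonglongrightarrow> L \<longrightarrow>
       (\<lambda>n. F (- of_real (ln (real (Suc n))) - Ln a)) \<longlonglongrightarrow> L' \<longrightarrow>
       norm (L - F (cis (- Arg a / 2))) \<le> C * exp (- norm a / 12) \<and>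
       norm (L' - F (- cis (- Arg a / 2))) \<le> C * exp (- norm a / 12)"
proof -
  define C where "C = max 12 (2 / cos (3 * pi / 8))"
  have C: "C \<ge> 12" "C \<ge> 2 / cos (3 * pi / 8)" by (auto simp: C_def)
  have upper: "norm (L - F (cis (- Arg a / 2))) \<le> C * exp (- norm a / 12) \<and>
       norm (L' - F (- cis (- Arg a / 2))) \<le> C * exp (- norm a / 12)"
    if a: "Re a > 0" "norm a \<ge> 1" "Im a \<ge> 0"
      and F: "\<And>s. (F has_field_derivative exp (- a * psi s)) (at s)"
      and L: "(\<lambda>n. F (of_real (ln (real (Suc n))) - Ln a)) \<longlonglongrightarrow> L"
      and L': "(\<lambda>n. F (- of_real (ln (real (Suc n))) - Ln a)) \<longlonglongrightarrow> L'"
    for a F L L'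
  proof -
    define b where "b = Arg a / 2"
    have "a \<noteq> 0" using a by auto
    hence "\<bar>Arg a\<bar> < pi / 2" "Arg a \<ge> 0"
      using a Re_Ln_pos_lt [of a] Im_Ln_pos_le [of a] by (auto simp: Arg_eq_Im_Ln)
    hence b: "0 \<le> b" "b < pi / 4" by (auto simp: b_def)
    have a_eq: "a = of_real (norm a) * cis (2 * b)"
      using rcis_cmod_Arg [of a] by (simp add: b_def rcis_def)
    have start: "Re (cis (2 * b) * psi w) \<ge> 1 / 4" if "w = cis (-b) \<or> w = - cis (-b)" for w
    proof -
      have "norm w = 1" "w\<^sup>2 = cis (- (2 * b))"
        using that by (auto simp: power2_eq_square cis_mult)
      moreover have "inverse (cis (- (2 * b))) = cis (2 * b)"
        by (subst cis_inverse) simp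
      ultimately show ?thesis
        using Re_psi_unit_ge [of w] by (simp only: divide_inverse mult.commute)
    qed
    have "norm (L - F (cis (-b))) \<le> 2 / cos (3 * pi / 8) * exp (- norm a / 4)"
      by (rule tail_right [OF b, of "norm a" F L, unfolded a_eq [symmetric], OF a(2) F L start]) auto
    also have "\<dots> \<le> C * exp (- norm a / 12)"
      using C by (intro mult_mono) auto
    finally have 1: "norm (L - F (cis (-b))) \<le> C * exp (- norm a / 12)" .
    have "norm (L' - F (- cis (-b))) \<le> 12 * exp (- norm a / 12)"
      by (rule tail_left [OF b, of "norm a" F L', unfolded a_eq [symmetric], OF a(2) F L' start]) auto
    also have "\<dots> \<le> C * exp (- norm a / 12)"
      using C by (intro mult_mono) auto
    finally have 2: "norm (L' - F (- cis (-b))) \<le> C * exp (- norm a / 12)" .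
    from 1 2 show ?thesis by (simp add: b_def)
  qed
  have "norm (L - F (cis (- Arg a / 2))) \<le> C * exp (- norm a / 12) \<and>
       norm (L' - F (- cis (- Arg a / 2))) \<le> C * exp (- norm a / 12)"
    if a: "Re a > 0" "norm a \<ge> 1"
      and F: "\<And>s. (F has_field_derivative exp (- a * psi s)) (at s)"
      and L: "(\<lambda>n. F (of_real (ln (real (Suc n))) - Ln a)) \<longlonglongrightarrow> L"
      and L': "(\<lambda>n. F (- of_real (ln (real (Suc n))) - Ln a)) \<longlonglongrightarrow> L'"
    for a F L L'
  proof (cases "Im a \<ge> 0")
    case True
    with that upper show ?thesis by blast
  next
    case False
    \<comment> \<open>The reflected function is a primitive of the integrand belonging to cnj a,
      whose imaginary part is positive.\<close>
    define G where "G = (\<lambda>s. cnj (F (cnj s)))"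
    have a': "a \<notin> \<real>\<^sub>\<le>\<^sub>0" using a by (auto simp: complex_nonpos_Reals_iff)
    have psi_cnj: "cnj (psi s) = psi (cnj s)" for s
      by (simp add: psi_def exp_cnj)
    have Ln_cnj: "Ln (cnj a) = cnj (Ln a)"
      using cnj_Ln [OF a'] by simp
    have G: "(G has_field_derivative exp (- cnj a * psi s)) (at s)" for s
      using has_field_derivative_cnj_cnj [OF F [of "cnj s"]]
      by (simp add: G_def o_def psi_cnj exp_cnj)
    have 1: "(\<lambda>n. G (of_real (ln (real (Suc n))) - Ln (cnj a))) \<longlonglongrightarrow> cnj L"
      using tendsto_cnj [OF L] by (simp add: G_def Ln_cnj)
    have 2: "(\<lambda>n. G (- of_real (ln (real (Suc n))) - Ln (cnj a))) \<longlonglongrightarrow> cnj L'"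
      using tendsto_cnj [OF L'] by (simp add: G_def Ln_cnj)
    have "norm (cnj L - G (cis (- Arg (cnj a) / 2))) \<le> C * exp (- norm (cnj a) / 12) \<and>
       norm (cnj L' - G (- cis (- Arg (cnj a) / 2))) \<le> C * exp (- norm (cnj a) / 12)"
      by (rule upper [OF _ _ _ G 1 2]) (use a False in simp_all)
    moreover have "Arg (cnj a) = - Arg a"
      using a' False by (auto simp: Arg_cnj complex_is_Real_iff complex_nonpos_Reals_iff Arg_eq_pi_iff)
    moreover have "norm (cnj x - cnj y) = norm (x - y)" for x y
      by (metis complex_cnj_diff complex_mod_cnj)
    ultimately show ?thesis
      by (simp add: G_def cis_cnj)
  qed
  moreover have "C > 0" using C by simp
  ultimately show ?thesis by (intro exI [of _ C] conjI allI impI) simp_all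
qed

section \<open>Assembling the expansions of the two gamma functions\<close>

lemma exp_minus_bound: "x > 0 \<Longrightarrow> exp (- x) \<le> fact n / x ^ n" for x :: real
proof -
  assume x: "x > 0"
  have "(\<Sum>k\<in>{n}. x ^ k /\<^sub>R fact k) \<le> (\<Sum>k. x ^ k /\<^sub>R fact k)"
    using x by (intro sum_le_suminf summable_exp_generic) auto
  also have "\<dots> = exp x" by (simp add: exp_def)
  finally show ?thesis using x by (simp add: exp_minus field_simps)
qed

lemma csqrt_polar:
  assumes "Re a > 0"
  shows "csqrt a = of_real (sqrt (norm a)) * cis (Arg a / 2)"
proof (rule csqrt_unique)
  have a0: "a \<noteq> 0" using assms by auto
  have "(of_real (sqrt (norm a)) * cis (Arg a / 2))\<^sup>2 =
          of_real (sqrt (norm a) * sqrt (norm a)) * (cis (Arg a / 2) * cis (Arg a / 2))"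
    by (simp only: power2_eq_square of_real_mult mult_ac)
  also have "\<dots> = of_real (norm a) * cis (Arg a)"
    by (simp only: cis_mult field_sum_of_halves real_sqrt_mult_self abs_norm_cancel)
  also have "\<dots> = a"
    using rcis_cmod_Arg [of a] by (simp only: rcis_def)
  finally show "(of_real (sqrt (norm a)) * cis (Arg a / 2))\<^sup>2 = a" .
  have "\<bar>Arg a\<bar> < pi / 2"
    using assms Re_Ln_pos_lt [OF a0] unfolding Arg_eq_Im_Ln [OF a0] by blast
  hence "cos (Arg a / 2) > 0"
    by (intro cos_gt_zero_pi) auto
  thus "0 < Re (of_real (sqrt (norm a)) * cis (Arg a / 2)) \<or>
        Re (of_real (sqrt (norm a)) * cis (Arg a / 2)) = 0 \<and>
        0 \<le> Im (of_real (sqrt (norm a)) * cis (Arg a / 2))"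
    using a0 by simp
qed

text \<open>Matches the end point of the steepest-descent segment with the starting point of the
  tails.\<close>

lemma inverse_csqrt_normalized:
  assumes "Re a > 0"
  shows "(1 / csqrt a) / of_real (norm (1 / csqrt a)) = cis (- Arg a / 2)"
proof -
  have inv: "inverse (cis (Arg a / 2)) = cis (- Arg a / 2)"
    by (simp only: cis_inverse minus_divide_left)
  have "norm (1 / csqrt a) = 1 / sqrt (norm a)"
    unfolding csqrt_polar [OF assms] norm_divide norm_mult by simp
  moreover have "1 / csqrt a = of_real (1 / sqrt (norm a)) * cis (- Arg a / 2)"
    unfolding csqrt_polar [OF assms] inv [symmetric]
    by (simp only: divide_inverse inverse_mult_distrib of_real_inverse mult_1_left)
  moreover have "a \<noteq> 0" using assms by auto
  hence "sqrt (norm a) \<noteq> 0" by simp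
  ultimately show ?thesis by (simp del: cis_cnj)
qed

text \<open>The integrand depends on \<epsilon> only through its square, so
  \<open>laplace_expansion\<close> applies to the same primitive in the directions \<epsilon> and
  -\<epsilon>. One segment and its tail give \<open>upper_Gamma\<close>, both together give
  \<open>Gamma\<close>, hence the factor 2 in the error.\<close>

lemma Gamma_expansions:
  fixes M :: nat
  defines "K \<equiv> \<lambda>a. a powr a * exp (- a)"
  shows "\<exists>C. \<forall>a. Re a > 0 \<longrightarrow> norm a \<ge> 1 \<longrightarrow>
       norm (upper_Gamma a a / K a - (\<Sum>k<M. of_real (laplace_coeff k) * (1 / csqrt a) ^ (k + 1)))
         \<le> C * norm ((1 / csqrt a) ^ (M + 1)) \<and>
       norm (Gamma a / K a - (\<Sum>k<M. of_real (laplace_coeff k) * (1 + (-1) ^ k) * (1 / csqrt a) ^ (k + 1)))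
         \<le> 2 * C * norm ((1 / csqrt a) ^ (M + 1))"
proof -
  obtain C1 where "\<forall>\<epsilon> F. \<epsilon> \<noteq> 0 \<longrightarrow> (\<forall>s. (F has_field_derivative exp (- psi s / \<epsilon>\<^sup>2)) (at s)) \<longrightarrow>
           norm (F (\<epsilon> / of_real (norm \<epsilon>)) - F 0 - (\<Sum>k<M. of_real (laplace_coeff k) * \<epsilon> ^ (k + 1)))
             \<le> C1 * norm \<epsilon> ^ (M + 1)"
    using laplace_expansion [of M] by (elim exE)
  hence C1: "norm (F (\<epsilon> / of_real (norm \<epsilon>)) - F 0 - (\<Sum>k<M. of_real (laplace_coeff k) * \<epsilon> ^ (k + 1)))
             \<le> C1 * norm \<epsilon> ^ (M + 1)"
    if "\<epsilon> \<noteq> 0" "\<And>s. (F has_field_derivative exp (- psi s / \<epsilon>\<^sup>2)) (at s)" for F \<epsilon>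
    using that by simp
  obtain C2 where C2: "C2 > 0" and *: "\<forall>a F L L'. Re a > 0 \<longrightarrow> norm a \<ge> 1 \<longrightarrow>
       (\<forall>s. (F has_field_derivative exp (- a * psi s)) (at s)) \<longrightarrow>
       (\<lambda>n. F (of_real (ln (real (Suc n))) - Ln a)) \<longlonglongrightarrow> L \<longrightarrow>
       (\<lambda>n. F (- of_real (ln (real (Suc n))) - Ln a)) \<longlonglongrightarrow> L' \<longrightarrow>
       norm (L - F (cis (- Arg a / 2))) \<le> C2 * exp (- norm a / 12) \<and>
       norm (L' - F (- cis (- Arg a / 2))) \<le> C2 * exp (- norm a / 12)"
    using contour_tail_bounds by (elim exE conjE)
  define C where "C = C1 + C2 * fact (M + 1) * 12 ^ (M + 1)"
  show ?thesis
  proof (intro exI [of _ C] allI impI)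
    fix a :: complex assume a: "Re a > 0" "norm a \<ge> 1"
    define \<epsilon> where "\<epsilon> = 1 / csqrt a"
    have a0: "a \<noteq> 0" using a by auto
    hence \<epsilon>0: "\<epsilon> \<noteq> 0" by (simp add: \<epsilon>_def)
    have \<epsilon>2: "\<epsilon>\<^sup>2 = 1 / a" by (simp add: \<epsilon>_def power_divide)
    have n\<epsilon>: "norm \<epsilon> ^ 2 = 1 / norm a"
      unfolding norm_power [symmetric] \<epsilon>2 by (simp add: norm_divide)
    have n\<epsilon>1: "norm \<epsilon> \<le> 1"
    proof (rule power2_le_imp_le)
      show "norm \<epsilon> ^ 2 \<le> 1 ^ 2"
        unfolding n\<epsilon> using a(2) by (simp add: divide_le_eq)
    qed simp
    have \<epsilon>_unit: "\<epsilon> / of_real (norm \<epsilon>) = cis (- Arg a / 2)"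
      unfolding \<epsilon>_def using a(1) by (rule inverse_csqrt_normalized)
    have hol: "(\<lambda>s. exp (- a * psi s)) holomorphic_on UNIV"
      unfolding psi_def by (intro holomorphic_intros)
    have "\<exists>F. \<forall>s. (F has_field_derivative exp (- a * psi s)) (at s)"
      by (rule holomorphic_convex_primitive' [OF convex_UNIV open_UNIV hol]) auto
    then obtain F where "\<forall>s. (F has_field_derivative exp (- a * psi s)) (at s)"
      by (elim exE)
    hence F: "(F has_field_derivative exp (- a * psi s)) (at s)" for s
      by (rule spec)
    have F': "(F has_field_derivative exp (- psi s / \<epsilon>\<^sup>2)) (at s)"
             "(F has_field_derivative exp (- psi s / (-\<epsilon>)\<^sup>2)) (at s)" for s
      using F [of s] a0 by (simp_all add: \<epsilon>2 mult.commute)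
    \<comment> \<open>By \<open>Gamma_primitive_limits\<close> these are the limits of F at the two
      ends of the line; thus the quotients in the claim are L - F 0 and L - L'.\<close>
    define L where "L = upper_Gamma a a / K a + F 0"
    define L' where "L' = L - Gamma a / K a"
    define S where "S = (\<Sum>k<M. of_real (laplace_coeff k) * \<epsilon> ^ (k + 1))"
    define S' where "S' = (\<Sum>k<M. of_real (laplace_coeff k) * (-\<epsilon>) ^ (k + 1))"
    have tl: "norm (L - F (cis (- Arg a / 2))) \<le> C2 * exp (- norm a / 12)"
             "norm (L' - F (- cis (- Arg a / 2))) \<le> C2 * exp (- norm a / 12)"
      using * [rule_format, OF a F Gamma_primitive_limits [OF a(1) F]]
      unfolding L_def L'_def K_def by blast+
    have core: "norm (F (cis (- Arg a / 2)) - F 0 - S) \<le> C1 * norm \<epsilon> ^ (M + 1)"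
               "norm (F (- cis (- Arg a / 2)) - F 0 - S') \<le> C1 * norm \<epsilon> ^ (M + 1)"
      using C1 [OF \<epsilon>0 F'(1)] C1 [of "-\<epsilon>", OF _ F'(2)] \<epsilon>0 \<epsilon>_unit unfolding S_def S'_def by simp_all
    have "exp (- norm a / 12) = exp (- (norm a / 12))"
      by simp
    also have "\<dots> \<le> fact (M + 1) / (norm a / 12) ^ (M + 1)"
      by (rule exp_minus_bound) (use a0 in simp)
    \<comment> \<open>As 1/|a| is the square of |\<epsilon>|, twice the required power appears; half
      of it is then bounded by 1.\<close>
    also have "\<dots> = fact (M + 1) * 12 ^ (M + 1) * (norm \<epsilon> ^ (M + 1) * norm \<epsilon> ^ (M + 1))"
      unfolding power_mult_distrib [symmetric] using n\<epsilon>
      by (simp add: power2_eq_square power_divide del: power_Suc)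
    also have "\<dots> \<le> fact (M + 1) * 12 ^ (M + 1) * (1 * norm \<epsilon> ^ (M + 1))"
      using n\<epsilon>1 by (intro mult_left_mono mult_right_mono power_le_one) auto
    finally have "C2 * exp (- norm a / 12) \<le> C2 * (fact (M + 1) * 12 ^ (M + 1) * (1 * norm \<epsilon> ^ (M + 1)))"
      using C2 by (intro mult_left_mono) auto
    hence small: "C2 * exp (- norm a / 12) + C1 * norm \<epsilon> ^ (M + 1) \<le> C * norm \<epsilon> ^ (M + 1)"
      by (simp add: C_def algebra_simps)
    have "norm (L - (F 0 + S)) \<le> C2 * exp (- norm a / 12) + C1 * norm \<epsilon> ^ (M + 1)"
      by (rule norm_diff_triangle_le [OF tl(1)]) (use core(1) in \<open>simp add: diff_diff_eq\<close>)
    with small have 1: "norm (L - (F 0 + S)) \<le> C * norm \<epsilon> ^ (M + 1)" by linarith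
    have "norm (L' - (F 0 + S')) \<le> C2 * exp (- norm a / 12) + C1 * norm \<epsilon> ^ (M + 1)"
      by (rule norm_diff_triangle_le [OF tl(2)]) (use core(2) in \<open>simp add: diff_diff_eq\<close>)
    with small have 2: "norm (L' - (F 0 + S')) \<le> C * norm \<epsilon> ^ (M + 1)" by linarith
    have "Gamma a / K a - (S - S') = (L - (F 0 + S)) - (L' - (F 0 + S'))"
      by (simp add: L'_def algebra_simps)
    hence "norm (Gamma a / K a - (S - S')) = norm ((L - (F 0 + S)) - (L' - (F 0 + S')))"
      by (simp only:)
    also have "\<dots> \<le> norm (L - (F 0 + S)) + norm (L' - (F 0 + S'))"
      by (rule norm_triangle_ineq4)
    finally have 3: "norm (Gamma a / K a - (S - S')) \<le> 2 * C * norm \<epsilon> ^ (M + 1)"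
      using 1 2 by linarith
    \<comment> \<open>The sign of (-\<epsilon>)^(k+1) doubles the terms with k even and cancels
      those with k odd.\<close>
    have "S - S' = (\<Sum>k<M. of_real (laplace_coeff k) * (1 + (-1) ^ k) * \<epsilon> ^ (k + 1))"
      unfolding S_def S'_def sum_subtractf [symmetric]
      by (intro sum.cong) (auto simp: power_minus [of \<epsilon>] algebra_simps)
    with 1 3 show "norm (upper_Gamma a a / K a - (\<Sum>k<M. of_real (laplace_coeff k) * (1 / csqrt a) ^ (k + 1)))
         \<le> C * norm ((1 / csqrt a) ^ (M + 1)) \<and>
       norm (Gamma a / K a - (\<Sum>k<M. of_real (laplace_coeff k) * (1 + (-1) ^ k) * (1 / csqrt a) ^ (k + 1)))
         \<le> 2 * C * norm ((1 / csqrt a) ^ (M + 1))"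
      unfolding \<epsilon>_def [symmetric] S_def [symmetric] by (simp add: L_def norm_power norm_mult)
  qed
qed

lemma eventually_sector_Re_pos:
  "eventually (\<lambda>a. Re a > 0 \<and> norm a \<ge> 1) (at_infinity_sector (pi / 2))"
  unfolding eventually_at_infinity_sector
proof (intro exI [of _ 1] allI impI conjI)
  fix a :: complex assume a: "1 \<le> norm a \<and> a \<noteq> 0 \<and> \<bar>Arg a\<bar> < pi / 2"
  hence "Re (Ln a) = ln (norm a)" "\<bar>Im (Ln a)\<bar> < pi / 2"
    by (auto simp: Arg_eq_Im_Ln)
  thus "Re a > 0" using a Re_Ln_pos_lt [of a] by blast
qed auto

lemma sum_lessThan_double:
  fixes f :: "nat \<Rightarrow> 'a :: comm_monoid_add"
  shows "(\<Sum>k<2 * m + 2. f k) = (\<Sum>i\<le>m. f (2 * i) + f (2 * i + 1))"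
  by (induction m) (auto simp: numeral_2_eq_2 add_ac)

text \<open>The expansions with 2m + 2 terms, grouped in pairs: the index 2i contributes A_(2i)(0)
  and the index 2i + 1 contributes B_(2i+1)(0). The second sum contains no B because its odd terms
  cancel.\<close>

lemma Gamma_sector_bigo:
  fixes m :: nat
  defines "K \<equiv> \<lambda>a. a powr a * exp (- a)"
  defines "SA \<equiv> \<lambda>a. \<Sum>i\<le>m. poly (A_poly (2 * i)) 0 / a ^ i"
  defines "SB \<equiv> \<lambda>a. \<Sum>i\<le>m. poly (B_poly (2 * i + 1)) 0 / a ^ i"
  defines "\<epsilon> \<equiv> \<lambda>a. 1 / csqrt a"
  shows "(\<lambda>a. upper_Gamma a a / K a - (\<epsilon> a * of_real (sqrt (2 * pi)) * SA a / 2 - \<epsilon> a ^ 2 * SB a))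
           \<in> O[at_infinity_sector (pi / 2)](\<lambda>a. \<epsilon> a ^ (2 * m + 3))" (is ?th1)
    and "(\<lambda>a. Gamma a / K a - \<epsilon> a * of_real (sqrt (2 * pi)) * SA a)
           \<in> O[at_infinity_sector (pi / 2)](\<lambda>a. \<epsilon> a ^ (2 * m + 3))" (is ?th2)
proof -
  have sqrt2: "sqrt (2 * pi) = 2 * sqrt (pi / 2)"
    using real_sqrt_mult [of 4 "pi / 2"] by simp
  have A0: "poly (A_poly (2 * i + 1)) 0 = 0" and B0: "poly (B_poly (2 * i)) 0 = 0" for i
    by (simp_all add: poly_A_poly_0 poly_B_poly_0)
  have \<epsilon>: "1 / csqrt a = \<epsilon> a" for a
    by (simp add: \<epsilon>_def)
  have \<epsilon>_pow: "\<epsilon> a ^ (2 * i) = 1 / a ^ i" for a i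
    by (simp add: \<epsilon>_def power_mult power_divide)
  obtain C where C: "\<forall>a. Re a > 0 \<longrightarrow> norm a \<ge> 1 \<longrightarrow>
       norm (upper_Gamma a a / (a powr a * exp (- a)) -
             (\<Sum>k<2 * m + 2. of_real (laplace_coeff k) * (1 / csqrt a) ^ (k + 1)))
         \<le> C * norm ((1 / csqrt a) ^ (2 * m + 2 + 1)) \<and>
       norm (Gamma a / (a powr a * exp (- a)) -
             (\<Sum>k<2 * m + 2. of_real (laplace_coeff k) * (1 + (-1) ^ k) * (1 / csqrt a) ^ (k + 1)))
         \<le> 2 * C * norm ((1 / csqrt a) ^ (2 * m + 2 + 1))"
    using Gamma_expansions [of "2 * m + 2"] by (elim exE)
  have 1: "(\<Sum>k<2 * m + 2. of_real (laplace_coeff k) * \<epsilon> a ^ (k + 1)) =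
             \<epsilon> a * of_real (sqrt (2 * pi)) * SA a / 2 - \<epsilon> a ^ 2 * SB a" for a
  proof -
    have "(\<Sum>k<2 * m + 2. of_real (laplace_coeff k) * \<epsilon> a ^ (k + 1)) =
            (\<Sum>i\<le>m. of_real (sqrt (pi / 2)) * poly (A_poly (2 * i)) 0 * (\<epsilon> a * \<epsilon> a ^ (2 * i)) -
                    poly (B_poly (2 * i + 1)) 0 * (\<epsilon> a ^ 2 * \<epsilon> a ^ (2 * i)))"
      unfolding sum_lessThan_double laplace_coeff A0 B0
      by (intro sum.cong) (simp_all add: power2_eq_square mult_ac)
    also have "\<dots> = \<epsilon> a * of_real (sqrt (2 * pi)) * SA a / 2 - \<epsilon> a ^ 2 * SB a"
      unfolding \<epsilon>_pow SA_def SB_def sqrt2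
      by (simp add: sum_subtractf sum_distrib_left mult_ac)
    finally show ?thesis .
  qed
  have 2: "(\<Sum>k<2 * m + 2. of_real (laplace_coeff k) * (1 + (-1) ^ k) * \<epsilon> a ^ (k + 1)) =
             \<epsilon> a * of_real (sqrt (2 * pi)) * SA a" for a
  proof -
    have "(\<Sum>k<2 * m + 2. of_real (laplace_coeff k) * (1 + (-1) ^ k) * \<epsilon> a ^ (k + 1)) =
            (\<Sum>i\<le>m. 2 * (of_real (sqrt (pi / 2)) * poly (A_poly (2 * i)) 0 * (\<epsilon> a * \<epsilon> a ^ (2 * i))))"
      unfolding sum_lessThan_double laplace_coeff A0 B0
      by (intro sum.cong) (simp_all add: mult_ac)
    also have "\<dots> = \<epsilon> a * of_real (sqrt (2 * pi)) * SA a"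
      unfolding \<epsilon>_pow SA_def sqrt2
      by (simp add: sum_distrib_left mult_ac)
    finally show ?thesis .
  qed
  have e: "2 * m + 2 + 1 = 2 * m + 3" by simp
  note C = C [unfolded \<epsilon>, unfolded 1 2 e]
  show ?th1
    by (rule bigoI [of _ C], rule eventually_mono [OF eventually_sector_Re_pos])
       (use C in \<open>simp add: K_def\<close>)
  show ?th2
    by (rule bigoI [of _ "2 * C"], rule eventually_mono [OF eventually_sector_Re_pos])
       (use C in \<open>simp add: K_def\<close>)
qed

subsection \<open>The expansion in the sector\<close>

lemma E_coeff_quotient_bigo:
  "(\<lambda>a. (\<Sum>k\<le>m. poly (B_poly (2 * k + 1)) 0 / a ^ k) / (\<Sum>k\<le>m. poly (A_poly (2 * k)) 0 / a ^ k) -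
         (\<Sum>k\<le>m. E_coeff k / a ^ k)) \<in> O[at_infinity](\<lambda>a::complex. 1 / a ^ (m + 1))"
  using fps_quotient_asymp [of "Abs_fps (\<lambda>i. poly (A_poly (2 * i)) 0)" "Abs_fps (\<lambda>i. poly (B_poly (2 * i + 1)) 0)" m]
  by (simp add: E_coeff_def A_B_poly_examples)

lemma tendsto_sum_power_inverse:
  fixes c :: "nat \<Rightarrow> complex"
  shows "((\<lambda>a. \<Sum>k\<le>m. c k / a ^ k) \<longlongrightarrow> c 0) at_infinity"
proof -
  have "((\<lambda>a. \<Sum>k\<le>m. c k * inverse a ^ k) \<longlongrightarrow> (\<Sum>k\<le>m. c k * 0 ^ k)) at_infinity"
    by (intro tendsto_intros tendsto_inverse_0)
  also have "(\<Sum>k\<le>m. c k * 0 ^ k) = c 0"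
    by (simp add: sum.atMost_shift)
  finally show ?thesis
    by (simp add: divide_inverse power_inverse)
qed

text \<open>A positive factor keeps the root in the half-plane of principal values; this separates
  sqrt(2 pi) from the root of a.\<close>

lemma csqrt_of_real_mult:
  assumes "x > 0"
  shows "csqrt (of_real x * a) = of_real (sqrt x) * csqrt a"
proof (rule csqrt_unique)
  show "(of_real (sqrt x) * csqrt a)\<^sup>2 = of_real x * a"
    using assms by (simp add: power_mult_distrib flip: of_real_power)
  show "0 < Re (of_real (sqrt x) * csqrt a) \<or>
        Re (of_real (sqrt x) * csqrt a) = 0 \<and> 0 \<le> Im (of_real (sqrt x) * csqrt a)"
    using csqrt_principal [of a] assms by (auto simp: zero_less_mult_iff simp del: csqrt.simps)
qed

lemma Gamma_Q_sector_bigo: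
  "(\<lambda>a. Gamma_Q a a - (1 / 2 - 1 / csqrt (2 * of_real pi * a) * (\<Sum>k\<le>m. E_coeff k / a ^ k)))
     \<in> O[at_infinity_sector (pi / 2)](\<lambda>a. 1 / a ^ (m + 1))"
proof -
  let ?S = "at_infinity_sector (pi / 2)"
  define K where "K = (\<lambda>a::complex. a powr a * exp (- a))"
  define SA where "SA = (\<lambda>a. \<Sum>i\<le>m. poly (A_poly (2 * i)) 0 / a ^ i)"
  define SB where "SB = (\<lambda>a. \<Sum>i\<le>m. poly (B_poly (2 * i + 1)) 0 / a ^ i)"
  define SE where "SE = (\<lambda>a. \<Sum>k\<le>m. E_coeff k / a ^ k)"
  define \<epsilon> where "\<epsilon> = (\<lambda>a. 1 / csqrt a)"
  define c where "c = (of_real (sqrt (2 * pi)) :: complex)"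
  define T1 where "T1 = (\<lambda>a. upper_Gamma a a / K a - (\<epsilon> a * c * SA a / 2 - \<epsilon> a ^ 2 * SB a))"
  define T2 where "T2 = (\<lambda>a. Gamma a / K a - \<epsilon> a * c * SA a)"
  define T3 where "T3 = (\<lambda>a. SB a / SA a - SE a)"
  \<comment> \<open>Equals \<open>Gamma a / K a\<close> divided by \<epsilon>; it tends to
    \<open>c\<close>, so its inverse is bounded.\<close>
  define D where "D = (\<lambda>a. c * SA a + T2 a / \<epsilon> a)"
  have c: "c \<noteq> 0" by (simp add: c_def)
  have sector_le: "?S \<le> at_infinity"
    by (simp add: at_infinity_sector_def)
  have pow: "1 / a ^ (m + 1) = \<epsilon> a ^ (2 * m + 2)" for a
  proof -
    have "\<epsilon> a ^ (2 * (m + 1)) = 1 / a ^ (m + 1)"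
      unfolding \<epsilon>_def power_mult by (simp add: power_divide)
    thus ?thesis by simp
  qed
  have lim_eps: "(\<epsilon> \<longlongrightarrow> 0) ?S"
  proof -
    have "((\<lambda>a. inverse (norm a)) \<longlongrightarrow> 0) at_infinity"
      by (intro tendsto_inverse_0_at_top filterlim_norm_at_top)
    hence "((\<lambda>a. sqrt (inverse (norm a))) \<longlongrightarrow> sqrt 0) at_infinity"
      by (intro tendsto_intros)
    moreover have "norm (\<epsilon> a) = sqrt (inverse (norm a))" for a
      by (simp add: \<epsilon>_def norm_divide real_sqrt_divide inverse_eq_divide)
    ultimately have "((\<lambda>a. norm (\<epsilon> a)) \<longlongrightarrow> 0) at_infinity"
      by simp
    thus ?thesis
      using tendsto_mono [OF sector_le] tendsto_norm_zero_iff by blast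
  qed
  have lim_SA: "(SA \<longlongrightarrow> 1) ?S"
    using tendsto_mono [OF sector_le tendsto_sum_power_inverse [of "\<lambda>i. poly (A_poly (2 * i)) 0" m]]
    by (simp add: SA_def A_B_poly_examples)
  have lim_SE: "(SE \<longlongrightarrow> E_coeff 0) ?S"
    unfolding SE_def by (rule tendsto_mono [OF sector_le tendsto_sum_power_inverse])
  have T1: "T1 \<in> O[?S](\<lambda>a. \<epsilon> a ^ (2 * m + 3))" and T2: "T2 \<in> O[?S](\<lambda>a. \<epsilon> a ^ (2 * m + 3))"
    using Gamma_sector_bigo [of m] unfolding T1_def T2_def K_def SA_def SB_def \<epsilon>_def c_def by blast+
  have "T3 \<in> O[at_infinity](\<lambda>a. \<epsilon> a ^ (2 * m + 2))"
    using E_coeff_quotient_bigo [of m] unfolding T3_def SA_def SB_def SE_def pow .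
  hence T3: "T3 \<in> O[?S](\<lambda>a. \<epsilon> a ^ (2 * m + 2))"
    by (rule landau_o.big.filter_mono [OF sector_le])
  have div_eps: "(\<lambda>a. T a / \<epsilon> a) \<in> O[?S](\<lambda>a. \<epsilon> a ^ (2 * m + 2))"
    if "T \<in> O[?S](\<lambda>a. \<epsilon> a ^ (2 * m + 3))" for T
  proof -
    have "(\<lambda>a. T a * inverse (\<epsilon> a)) \<in> O[?S](\<lambda>a. \<epsilon> a ^ (2 * m + 3) * inverse (\<epsilon> a))"
      by (rule landau_o.big.mult [OF that landau_o.big_refl])
    also have "(\<lambda>a. \<epsilon> a ^ (2 * m + 3) * inverse (\<epsilon> a)) = (\<lambda>a. \<epsilon> a ^ (2 * m + 2))"
    proof
      fix a
      have "\<epsilon> a ^ (2 * m + 3) = \<epsilon> a ^ (2 * m + 2) * \<epsilon> a"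
        by (simp add: numeral_3_eq_3 mult.commute)
      \<comment> \<open>If \<epsilon> a is zero, as for a = 0 by the convention for division by
        zero, both sides are zero.\<close>
      thus "\<epsilon> a ^ (2 * m + 3) * inverse (\<epsilon> a) = \<epsilon> a ^ (2 * m + 2)"
        by (cases "\<epsilon> a = 0") simp_all
    qed
    finally show ?thesis by (simp only: divide_inverse)
  qed
  have eps_O1: "\<epsilon> \<in> O[?S](\<lambda>_. 1)" and SA_O1: "SA \<in> O[?S](\<lambda>_. 1)" and SE_O1: "(\<lambda>a. SE a / c) \<in> O[?S](\<lambda>_. 1)"
    using lim_eps lim_SA tendsto_divide [OF lim_SE tendsto_const c] by (auto intro!: bigoI_tendsto)
  have T2': "T2 \<in> O[?S](\<lambda>a. \<epsilon> a ^ (2 * m + 2))"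
  proof -
    note T2
    also have "(\<lambda>a. \<epsilon> a ^ (2 * m + 3)) = (\<lambda>a. \<epsilon> a ^ (2 * m + 2) * \<epsilon> a)"
      by (simp add: numeral_3_eq_3 mult.commute)
    also have "\<dots> \<in> O[?S](\<lambda>a. \<epsilon> a ^ (2 * m + 2) * 1)"
      by (rule landau_o.big.mult [OF landau_o.big_refl eps_O1])
    finally show ?thesis by simp
  qed
  have lim_D: "(D \<longlongrightarrow> c) ?S"
  proof -
    have "((\<lambda>a. \<epsilon> a ^ (2 * m + 2)) \<longlongrightarrow> 0) ?S"
      using tendsto_power [OF lim_eps, of "2 * m + 2"] by simp
    hence "(\<lambda>a. \<epsilon> a ^ (2 * m + 2)) \<in> o[?S](\<lambda>_. 1)"
      by (intro smalloI_tendsto) auto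
    with div_eps [OF T2] have "(\<lambda>a. T2 a / \<epsilon> a) \<in> o[?S](\<lambda>_. 1)"
      by (rule landau_o.big_small_trans)
    hence "((\<lambda>a. T2 a / \<epsilon> a) \<longlongrightarrow> 0) ?S"
      by (auto dest: smalloD_tendsto)
    from tendsto_add [OF tendsto_mult [OF tendsto_const lim_SA] this, of c] show ?thesis
      by (simp add: D_def)
  qed
  have invD: "(\<lambda>a. inverse (D a)) \<in> O[?S](\<lambda>_. 1)"
    using tendsto_inverse [OF lim_D c] by (auto intro!: bigoI_tendsto)
  have "(\<lambda>a. SE a / c * T2 a) \<in> O[?S](\<lambda>a. 1 * \<epsilon> a ^ (2 * m + 2))"
    by (rule landau_o.big.mult [OF SE_O1 T2'])
  moreover have "(\<lambda>a. \<epsilon> a * SA a * T3 a) \<in> O[?S](\<lambda>a. 1 * 1 * \<epsilon> a ^ (2 * m + 2))"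
    by (intro landau_o.big.mult eps_O1 SA_O1 T3)
  moreover have "(\<lambda>a. 1 / 2 * (T2 a / \<epsilon> a)) \<in> O[?S](\<lambda>a. \<epsilon> a ^ (2 * m + 2))"
    by (subst landau_o.big.cmult_in_iff) (use div_eps [OF T2] in simp_all)
  \<comment> \<open>This combination is \<open>D\<close> times the error of the claimed expansion:
    inserting the three error terms cancels c SA/2 and \<epsilon> SA SE. Division by \<epsilon>
    turns the order 2m + 3 into 2m + 2, which is a^(-m-1).\<close>
  ultimately have "(\<lambda>a. T1 a / \<epsilon> a - 1 / 2 * (T2 a / \<epsilon> a) + SE a / c * T2 a - \<epsilon> a * SA a * T3 a)
                     \<in> O[?S](\<lambda>a. \<epsilon> a ^ (2 * m + 2))"
    using div_eps [OF T1] by (intro sum_in_bigo) simp_all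
  hence "(\<lambda>a. (T1 a / \<epsilon> a - 1 / 2 * (T2 a / \<epsilon> a) + SE a / c * T2 a - \<epsilon> a * SA a * T3 a) * inverse (D a))
           \<in> O[?S](\<lambda>a. \<epsilon> a ^ (2 * m + 2) * 1)"
    by (rule landau_o.big.mult [OF _ invD])
  also have "?this \<longleftrightarrow> ?thesis"
  proof (intro landau_o.big.cong_ex)
    have "eventually (\<lambda>a. SA a \<noteq> 0) ?S" "eventually (\<lambda>a. D a \<noteq> 0) ?S"
      using tendsto_imp_eventually_ne [OF lim_SA] tendsto_imp_eventually_ne [OF lim_D c] by auto
    thus "eventually (\<lambda>a. (T1 a / \<epsilon> a - 1 / 2 * (T2 a / \<epsilon> a) + SE a / c * T2 a - \<epsilon> a * SA a * T3 a) * inverse (D a) =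
            Gamma_Q a a - (1 / 2 - 1 / csqrt (2 * of_real pi * a) * (\<Sum>k\<le>m. E_coeff k / a ^ k))) ?S"
      using eventually_sector_Re_pos
    proof eventually_elim
      case (elim a)
      have a0: "a \<noteq> 0" using elim by auto
      have e0: "\<epsilon> a \<noteq> 0" using a0 by (simp add: \<epsilon>_def)
      have K0: "K a \<noteq> 0" using a0 by (simp add: K_def)
      have "csqrt (of_real (2 * pi) * a) = c * csqrt a"
        unfolding c_def by (rule csqrt_of_real_mult) simp
      hence csq: "1 / csqrt (2 * of_real pi * a) = \<epsilon> a / c"
        by (simp add: \<epsilon>_def)
      have G: "Gamma a / K a = \<epsilon> a * D a"
        using e0 by (simp add: D_def T2_def field_simps)
      have U: "upper_Gamma a a / K a = T1 a + \<epsilon> a * c * SA a / 2 - \<epsilon> a ^ 2 * SB a"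
        by (simp add: T1_def)
      have SB: "SB a = SA a * (T3 a + SE a)"
        using elim by (simp add: T3_def)
      have "Gamma_Q a a = (upper_Gamma a a / K a) / (Gamma a / K a)"
        using K0 by (simp add: Gamma_Q_def)
      also have "\<dots> = (T1 a + \<epsilon> a * c * SA a / 2 - \<epsilon> a ^ 2 * (SA a * (T3 a + SE a))) / (\<epsilon> a * D a)"
        unfolding G U SB ..
      finally have Q: "Gamma_Q a a = \<dots>" .
      have T2D: "T2 a = \<epsilon> a * (D a - c * SA a)"
        using e0 by (simp add: D_def)
      have SE: "(\<Sum>k\<le>m. E_coeff k / a ^ k) = SE a"
        by (simp add: SE_def)
      show ?case
        unfolding Q csq SE T2D using e0 elim c
        by (simp add: field_simps power2_eq_square)
    qed
    show "eventually (\<lambda>a. \<epsilon> a ^ (2 * m + 2) * 1 = 1 / a ^ (m + 1)) ?S"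
      unfolding pow by simp
  qed
  finally show ?thesis .
qed

theorem mainTheorem1:
  shows "(\<forall>E :: nat \<Rightarrow> complex.
            (\<forall>m. (\<lambda>a. (\<Sum>k\<le>m. poly (B_poly (2 * k + 1)) 0 / a ^ k) /
                        (\<Sum>k\<le>m. poly (A_poly (2 * k)) 0 / a ^ k) -
                        (\<Sum>k\<le>m. E k / a ^ k))
                   \<in> O[at_infinity](\<lambda>a::complex. 1 / a ^ (m + 1)))
            \<longleftrightarrow> E = E_coeff) \<and>
         (\<forall>m. (\<lambda>a. Gamma_Q a a -
                      (1 / 2 - 1 / csqrt (2 * of_real pi * a) * (\<Sum>k\<le>m. E_coeff k / a ^ k)))
                \<in> O[at_infinity_sector (pi / 2)](\<lambda>a. 1 / a ^ (m + 1))) \<and>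
         E_coeff 0 = 1 / 3 \<and>
         E_coeff 1 = 1 / 540 \<and>
         E_coeff 2 = - 25 / 6048 \<and>
         E_coeff 3 = - 101 / 155520 \<and>
         E_coeff 4 = 3184811 / 3695155200 \<and>
         E_coeff 5 = 2745493 / 8151736320 \<and>
         E_coeff 6 = - 119937661 / 225740390400 \<and>
         E_coeff 7 = - 8325705316049 / 24176795811840000"
proof (intro conjI allI)
  fix E :: "nat \<Rightarrow> complex"
  show "(\<forall>m. (\<lambda>a. (\<Sum>k\<le>m. poly (B_poly (2 * k + 1)) 0 / a ^ k) /
                        (\<Sum>k\<le>m. poly (A_poly (2 * k)) 0 / a ^ k) -
                        (\<Sum>k\<le>m. E k / a ^ k))
                   \<in> O[at_infinity](\<lambda>a::complex. 1 / a ^ (m + 1)))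
            \<longleftrightarrow> E = E_coeff" (is "?lhs \<longleftrightarrow> _")
  proof
    assume E: ?lhs
    have "E_coeff = E"
    proof (rule sum_power_inverse_bigo_unique)
      fix m
      show "(\<lambda>a. (\<Sum>k\<le>m. E_coeff k / a ^ k) - (\<Sum>k\<le>m. E k / a ^ k)) \<in> O[at_infinity](\<lambda>a. 1 / a ^ (m + 1))"
        \<comment> \<open>Both sums approximate the same quotient, so subtracting the two estimates
          eliminates it.\<close>
        using sum_in_bigo(2) [OF E [rule_format, of m] E_coeff_quotient_bigo [of m]] by simp
    qed
    thus "E = E_coeff" ..
  qed (use E_coeff_quotient_bigo in blast)
next
  fix m
  show "(\<lambda>a. Gamma_Q a a - (1 / 2 - 1 / csqrt (2 * of_real pi * a) * (\<Sum>k\<le>m. E_coeff k / a ^ k)))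
          \<in> O[at_infinity_sector (pi / 2)](\<lambda>a. 1 / a ^ (m + 1))"
    by (rule Gamma_Q_sector_bigo)
qed (use E_coeff_values in simp_all)

end
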